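(* Suppose the verifier Alice and the prover Bob follow Protocol $\mathbf{Q}$ with the honest quantum behavior for Bob, both as described in the context. Then $$\Pr[\text{success}] \;\geq\; \cos^2\left(\frac{\pi}{8}\right) - \frac{5m\sigma^2}{q^2} - \frac{m\sigma}{2\tau}.$$
   Context: **Parameters.** $\lambda\ge 1$ is the security parameter; $n,m,q,Q,\sigma,\tau$ are functions of $\lambda$ such that: $\log q$ and $\log\sigma$ are polynomially bounded in $\lambda$ ($\log$ is base 2); $\sigma\ge 1$; $q$ is an odd prime; $Q=\lceil\log q\rceil$; $n=\lambda$; $m=n(2Q+1)$; $\tau=q/(4mQ)$. **Notation.** $\mathbb{Z}_q=\{0,\dots,q-1\}$ with arithmetic mod $q$; $|x|=\min\{x,q-x\}$ for $x\in\mathbb{Z}_q$; $\|v\|_\infty=\max_i|v_i|$. For $k\in\mathbb{Z}_q$, $[k]\in\{0,1\}^Q$ is its binary representation, least significant bit first; for $x\in\mathbb{Z}_q^n$, $[x]\in\{0,1\}^{nQ}$ is the concatenation of $[x_1],\dots,[x_n]$. $\oplus$ is bitwise XOR and $u\cdot z$ for bit strings is the inner product mod 2. $x\leftarrow S$ means uniform sampling from the finite set $S$, and $x\leftarrow\chi$ sampling from the distribution $\chi$. $G(s)$ ($s>0$) is the discrete Gaussian on $\mathbb{Z}$, with $P(X=x)\propto e^{-x^2/(2s^2)}$; $G(s,t)$ is $G(s)$ conditioned on $|X|\le t$; $\chi^m$ denotes $m$ independent samples. $X,Y$ are the Pauli matrices. **Trapdoors.** $\mathrm{GenTrap}()$ is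 a fixed probabilistic polynomial-time algorithm and $\mathrm{Invert}$ a fixed deterministic polynomial-time algorithm (always returning an element of $\mathbb{Z}_q^n$) such that: (1) $\mathrm{GenTrap}()$ returns $(A,t)$ with $A\in\mathbb{Z}_q^{m\times n}$ within statistical distance $nQ2^{-n/2}$ of uniform; (2) for every output $(A,t)$ of $\mathrm{GenTrap}()$, every $s\in\mathbb{Z}_q^n$ and every $e\in\mathbb{Z}_q^m$ with $\|e\|_\infty\le 2\tau$, $\mathrm{Invert}(A,As+e,t)=s$. **Protocol Q.** 1. Alice samples $s\leftarrow\mathbb{Z}_q^n$, $e\leftarrow G(\sigma,\tau)^m$ (reduced mod $q$), $(A,t)\leftarrow\mathrm{GenTrap}()$, and sets $v=As+e$, $pk=(A,v)$. She samples $b\leftarrow\{0,1\}$, $f\leftarrow\{0,1\}^m$ and sets $ct=(a,w)$ with $a=f^\top A\in\mathbb{Z}_q^n$, $w=f^\top v+b\lfloor q/4\rfloor\in\mathbb{Z}_q$. She sends $(pk,ct)$ to Bob. 2. Bob returns $(y,u)$ with $y\in\mathbb{Z}_q^m$, $u\in\{0,1\}^{nQ}$. 3. Alice samples $b'\leftarrow\{0,1\}$ and sends it to Bob. 4. Bob returns a bit $d'$. 5. Alice computes $x_0=\mathrm{Invert}(A,y,t)$, $x_1=\mathrm{Invert}(A,y+v,t)$ and $d=u\cdot([x_0]\oplus[x_1])$. 6. Success occurs iff $d\oplus d'=b\wedge b'$. **Honest quantum Bob.** In step 2, Bob prepares the normalized uniform superposition $$|\phi\rangle=\frac{1}{\sqrt{N}}\sum_{x\in\mathbb{Z}_q^n}\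 \sum_{c\in\{0,1\}}\ \sum_{g\in\mathbb{Z}_q^m,\ \|g\|_\infty\le\tau}|x\rangle|c\rangle|Ax-cv+g\rangle,$$ where $N$ is the number of triples $(x,c,g)$ in the sum and $|x\rangle$ is stored as the $nQ$ qubits $|[x]\rangle$. He measures the third register in the computational basis, obtaining $y$ and an $(nQ+1)$-qubit state $|\psi\rangle$ on the first two registers. With $r_{(i-1)Q+j}=2^j\pi a_i/q$ for $1\le i\le n$, $1\le j\le Q$, for each $k\in\{1,\dots,nQ\}$ he measures the $k$-th qubit of $|\psi\rangle$ in the eigenbasis of $(\cos r_k)X+(\sin r_k)Y$, with outcome $(-1)^{u_k}$. He applies $|0\rangle\mapsto|0\rangle,\ |1\rangle\mapsto e^{2\pi i w/q}|1\rangle$ to the remaining qubit $L$, and sends $(y,u_1,\dots,u_{nQ})$. In step 4, he sets $\xi=(-1)^{b'}\pi/4$, measures $L$ in the eigenbasis of $(\cos\xi)X+(\sin\xi)Y$, obtains outcome $(-1)^{d'}$, and sends $d'$. The probability is over all the randomness of Alice and all of Bob's measurement outcomes. *)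

theory Defs
  imports
    "HOL-Probability.Probability_Mass_Function"
    "HOL-Library.Landau_Symbols"
    "Jordan_Normal_Form.Char_Poly"
begin

unbundle no vec_syntax
unbundle no inner_syntax

text \<open>
  \<open>\<int>\<^sub>q\<close> is the set \<open>{0..<q}\<close> of integers. Vectors and matrices over \<open>\<int>\<^sub>q\<close> are integer
  vectors and matrices with entries in that set, so sums and products have to be
  followed by \<open>redv q\<close> or \<open>mod\<close>. Indices start at 0.
\<close>

definition Zvec :: "nat \<Rightarrow> nat \<Rightarrow> int vec set" where
  "Zvec q n = {x \<in> carrier_vec n. \<forall>i<n. x $ i \<in> {0..<int q}}"

definition Zmat :: "nat \<Rightarrow> nat \<Rightarrow> nat \<Rightarrow> int mat set" where
  "Zmat q m n = {A \<in> carrier_mat m n. \<forall>i<m. \<forall>j<n. A $$ (i, j) \<in> {0..<int q}}"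

definition redv :: "nat \<Rightarrow> int vec \<Rightarrow> int vec" where
  "redv q = map_vec (\<lambda>x. x mod int q)"

definition zq_abs :: "nat \<Rightarrow> int \<Rightarrow> int" where
  "zq_abs q x = min x (int q - x)"

definition zq_norm :: "nat \<Rightarrow> int vec \<Rightarrow> int" where
  "zq_norm q v = Max ((\<lambda>i. zq_abs q (v $ i)) ` {..<dim_vec v})"

definition bits :: "nat \<Rightarrow> int \<Rightarrow> bool list" where
  "bits Q k = map (bit k) [0..<Q]"

definition vec_bits :: "nat \<Rightarrow> int vec \<Rightarrow> bool list" where
  "vec_bits Q x = concat (map (bits Q) (list_of_vec x))"

definition bxor :: "bool list \<Rightarrow> bool list \<Rightarrow> bool list" where
  "bxor = map2 (\<noteq>)"

definition bdot :: "bool list \<Rightarrow> bool list \<Rightarrow> bool" where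
  "bdot u z \<longleftrightarrow> odd (\<Sum>i<length u. of_bool (u ! i \<and> z ! i) :: nat)"

definition gauss :: "real \<Rightarrow> int pmf" where
  "gauss s = embed_pmf (\<lambda>x. exp (- (real_of_int x)\<^sup>2 / (2 * s\<^sup>2)) /
                            (\<Sum>\<^sub>\<infinity>y::int. exp (- (real_of_int y)\<^sup>2 / (2 * s\<^sup>2))))"

definition tgauss :: "real \<Rightarrow> real \<Rightarrow> int pmf" where
  "tgauss s t = cond_pmf (gauss s) {x. \<bar>real_of_int x\<bar> \<le> t}"

definition iid_vec :: "nat \<Rightarrow> 'a pmf \<Rightarrow> 'a vec pmf" where
  "iid_vec m \<chi> = map_pmf vec_of_list (replicate_pmf m \<chi>)"

definition coin :: "bool pmf" where
  "coin = pmf_of_set UNIV"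

definition stat_dist :: "'a pmf \<Rightarrow> 'a pmf \<Rightarrow> real" where
  "stat_dist p r = (\<Sum>\<^sub>\<infinity>x. \<bar>pmf p x - pmf r x\<bar>) / 2"

text \<open>
  A state is its family of amplitudes with respect to a computational basis labelled by
  \<open>'b\<close>, with finite support. The computational basis of a register of \<open>N\<close> qubits is labelled
  by the bit strings of length \<open>N\<close>, and a tensor product by pairs of labels.
\<close>

type_synonym 'b state = "'b \<Rightarrow> complex"

definition ket :: "'b \<Rightarrow> 'b state" where
  "ket b = (\<lambda>b'. of_bool (b' = b))"

definition norm_sq :: "'b state \<Rightarrow> real" where
  "norm_sq \<psi> = (\<Sum>b | \<psi> b \<noteq> 0. (cmod (\<psi> b))\<^sup>2)"

definition normalize_state :: "'b state \<Rightarrow> 'b state" where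
  "normalize_state \<psi> = (\<lambda>b. \<psi> b / complex_of_real (sqrt (norm_sq \<psi>)))"

text \<open>
  Born rule for a measurement with operators \<open>K o\<close> applied to a normalized state: outcome \<open>o\<close>
  has probability \<open>\<parallel>K o \<psi>\<parallel>\<^sup>2\<close> and leaves the normalization of \<open>K o \<psi>\<close>.
\<close>

definition measurement :: "('o \<Rightarrow> 'a state \<Rightarrow> 'b state) \<Rightarrow> 'a state \<Rightarrow> ('o \<times> 'b state) pmf" where
  "measurement K \<psi> =
     map_pmf (\<lambda>o'. (o', normalize_state (K o' \<psi>))) (embed_pmf (\<lambda>o'. norm_sq (K o' \<psi>)))"

definition measure_snd :: "('a \<times> 'b) state \<Rightarrow> ('b \<times> 'a state) pmf" where
  "measure_snd = measurement (\<lambda>y \<phi> b. \<phi> (b, y))"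

definition pauli_X :: "complex mat" where
  "pauli_X = mat_of_rows_list 2 [[0, 1], [1, 0]]"

definition pauli_Y :: "complex mat" where
  "pauli_Y = mat_of_rows_list 2 [[0, - \<i>], [\<i>, 0]]"

definition xy_obs :: "real \<Rightarrow> complex mat" where
  "xy_obs r = complex_of_real (cos r) \<cdot>\<^sub>m pauli_X + complex_of_real (sin r) \<cdot>\<^sub>m pauli_Y"

text \<open>
  A unit eigenvector. When the eigenspace is one-dimensional, as for the eigenvalues
  \<open>1\<close> and \<open>-1\<close> of \<open>xy_obs r\<close>, it is unique up to a phase, which cancels in the projection below.
\<close>

definition unit_eigenvector :: "complex mat \<Rightarrow> complex \<Rightarrow> complex vec" where
  "unit_eigenvector M \<mu> = (SOME v. eigenvector M v \<mu> \<and> v \<bullet>c v = 1)"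

text \<open>The projection \<open>|v\<rangle>\<langle>v|\<close> acting on qubit \<open>k\<close>.\<close>

definition project_qubit :: "complex vec \<Rightarrow> nat \<Rightarrow> bool list state \<Rightarrow> bool list state" where
  "project_qubit v k \<psi> =
     (\<lambda>b. v $ of_bool (b ! k) * (\<Sum>c\<in>UNIV. cnj (v $ of_bool c) * \<psi> (b[k := c])))"

text \<open>Outcome \<open>u\<close> stands for the eigenvalue \<open>(-1)\<^sup>u\<close>.\<close>

definition measure_qubit :: "complex mat \<Rightarrow> nat \<Rightarrow> bool list state \<Rightarrow> (bool \<times> bool list state) pmf" where
  "measure_qubit M k = measurement (\<lambda>u. project_qubit (unit_eigenvector M ((-1) ^ of_bool u)) k)"

fun measure_qubits ::
  "(nat \<times> complex mat) list \<Rightarrow> bool list state \<Rightarrow> (bool list \<times> bool list state) pmf" where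
  "measure_qubits [] \<psi> = return_pmf ([], \<psi>)"
| "measure_qubits ((k, M) # ks) \<psi> = do {
     (u, \<psi>') \<leftarrow> measure_qubit M k \<psi>;
     (us, \<psi>'') \<leftarrow> measure_qubits ks \<psi>';
     return_pmf (u # us, \<psi>'')
   }"

definition phase_gate :: "real \<Rightarrow> nat \<Rightarrow> bool list state \<Rightarrow> bool list state" where
  "phase_gate \<theta> k \<psi> = (\<lambda>b. (if b ! k then cis \<theta> else 1) * \<psi> b)"

text \<open>
  Bob is given by his two moves; \<open>'st\<close> is the memory kept between them. The result is the
  event that success occurs.
\<close>

definition protocol_Q ::
  "nat \<Rightarrow> nat \<Rightarrow> nat \<Rightarrow> nat \<Rightarrow> real \<Rightarrow> real \<Rightarrow>
   (int mat \<times> bool list) pmf \<Rightarrow> (int mat \<Rightarrow> int vec \<Rightarrow> bool list \<Rightarrow> int vec) \<Rightarrow>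
   (int mat \<times> int vec \<Rightarrow> int vec \<times> int \<Rightarrow> ((int vec \<times> bool list) \<times> 'st) pmf) \<Rightarrow>
   ('st \<Rightarrow> bool \<Rightarrow> bool pmf) \<Rightarrow> bool pmf" where
  "protocol_Q n m q Q \<sigma> \<tau> GenTrap Invert bob\<^sub>1 bob\<^sub>2 = do {
     s \<leftarrow> pmf_of_set (Zvec q n);
     e \<leftarrow> map_pmf (redv q) (iid_vec m (tgauss \<sigma> \<tau>));
     (A, t) \<leftarrow> GenTrap;
     let v = redv q (A *\<^sub>v s + e);
     b \<leftarrow> coin;
     f \<leftarrow> pmf_of_set (Zvec 2 m);
     let a = redv q (transpose_mat A *\<^sub>v f);
     let w = (f \<bullet> v + of_bool b * \<lfloor>real q / 4\<rfloor>) mod int q;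
     ((y, u), st) \<leftarrow> bob\<^sub>1 (A, v) (a, w);
     b' \<leftarrow> coin;
     d' \<leftarrow> bob\<^sub>2 st b';
     let x\<^sub>0 = Invert A y t;
     let x\<^sub>1 = Invert A (redv q (y + v)) t;
     let d = bdot u (bxor (vec_bits Q x\<^sub>0) (vec_bits Q x\<^sub>1));
     return_pmf ((d \<noteq> d') \<longleftrightarrow> (b \<and> b'))
   }"

definition honest_triples :: "nat \<Rightarrow> nat \<Rightarrow> nat \<Rightarrow> real \<Rightarrow> (int vec \<times> bool \<times> int vec) set" where
  "honest_triples n m q \<tau> = Zvec q n \<times> UNIV \<times> {g \<in> Zvec q m. real_of_int (zq_norm q g) \<le> \<tau>}"

text \<open>The \<open>nQ + 1\<close> qubits of the first two registers are \<open>[x]\<close> followed by \<open>c\<close>.\<close>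

definition honest_state ::
  "nat \<Rightarrow> nat \<Rightarrow> nat \<Rightarrow> nat \<Rightarrow> real \<Rightarrow> int mat \<Rightarrow> int vec \<Rightarrow> (bool list \<times> int vec) state" where
  "honest_state n m q Q \<tau> A v = (\<lambda>z.
     1 / complex_of_real (sqrt (real (card (honest_triples n m q \<tau>)))) *
     (\<Sum>(x, c, g) \<in> honest_triples n m q \<tau>.
        ket (vec_bits Q x @ [c], redv q (A *\<^sub>v x - of_bool c \<cdot>\<^sub>v v + g)) z))"

text \<open>
  With 0-based \<open>i\<close> and \<open>j\<close>, the qubit in position \<open>i * Q + j\<close> is bit \<open>j\<close> of \<open>x\<^sub>i\<close>, and its angle
  is \<open>2\<^sup>j\<^sup>+\<^sup>1 \<pi> a\<^sub>i / q\<close>.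
\<close>

definition honest_bob\<^sub>1 ::
  "nat \<Rightarrow> nat \<Rightarrow> nat \<Rightarrow> nat \<Rightarrow> real \<Rightarrow> int mat \<times> int vec \<Rightarrow> int vec \<times> int \<Rightarrow>
   ((int vec \<times> bool list) \<times> bool list state) pmf" where
  "honest_bob\<^sub>1 n m q Q \<tau> = (\<lambda>(A, v) (a, w). do {
     (y, \<psi>) \<leftarrow> measure_snd (honest_state n m q Q \<tau> A v);
     (u, \<psi>') \<leftarrow> measure_qubits
       [(i * Q + j, xy_obs (2 ^ (j + 1) * pi * real_of_int (a $ i) / real q)).
          i \<leftarrow> [0..<n], j \<leftarrow> [0..<Q]] \<psi>;
     return_pmf ((y, u), phase_gate (2 * pi * real_of_int w / real q) (n * Q) \<psi>')
   })"

definition honest_bob\<^sub>2 :: "nat \<Rightarrow> nat \<Rightarrow> bool list state \<Rightarrow> bool \<Rightarrow> bool pmf" where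
  "honest_bob\<^sub>2 n Q \<psi> b' =
     map_pmf fst (measure_qubit (xy_obs ((-1) ^ of_bool b' * pi / 4)) (n * Q) \<psi>)"

definition poly_bounded :: "(nat \<Rightarrow> real) \<Rightarrow> bool" where
  "poly_bounded f \<longleftrightarrow> (\<exists>k. f \<in> O(\<lambda>x. real x ^ k))"

text \<open>
  Deterministic machines with one two-way infinite tape. States and symbols are numbers
  below \<open>B\<close>; the start state is 0, the halting state is 1, the blank is 0. Transitions map
  a state and a scanned symbol to a state, a symbol to write and a head movement.
  A configuration consists of state, head position and tape.
\<close>

type_synonym tm = "nat \<Rightarrow> nat \<Rightarrow> nat \<times> nat \<times> int"

definition tm_wf :: "nat \<Rightarrow> tm \<Rightarrow> bool" where
  "tm_wf B M \<longleftrightarrow> 4 \<le> B \<and> (\<forall>p<B. \<forall>s<B. M p s \<in> {..<B} \<times> {..<B} \<times> {-1, 0, 1})"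

definition tm_step :: "tm \<Rightarrow> nat \<times> int \<times> (int \<Rightarrow> nat) \<Rightarrow> nat \<times> int \<times> (int \<Rightarrow> nat)" where
  "tm_step M = (\<lambda>(p, h, tape).
     if p = 1 then (p, h, tape)
     else let (p', s, d) = M p (tape h) in (p', h + d, tape(h := s)))"

definition tape_of :: "nat list \<Rightarrow> int \<Rightarrow> nat" where
  "tape_of w = (\<lambda>i. if 0 \<le> i \<and> nat i < length w then w ! nat i else 0)"

definition polytime :: "'i set \<Rightarrow> ('i \<Rightarrow> nat list) \<Rightarrow> ('i \<Rightarrow> nat list) \<Rightarrow> bool" where
  "polytime D inp out \<longleftrightarrow>
     (\<exists>B M (p :: nat poly). tm_wf B M \<and>
        (\<forall>x\<in>D. \<exists>h. (tm_step M ^^ poly p (length (inp x))) (0, 0, tape_of (inp x)) =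
                    (1, h, tape_of (out x))))"

text \<open>
  Words use 1 and 2 for the bits 0 and 1, and 3 as a terminator. Every input begins with
  the security parameter in unary and with \<open>q\<close> in binary.
\<close>

definition enc_bits :: "bool list \<Rightarrow> nat list" where
  "enc_bits bs = map (\<lambda>b. if b then 2 else 1) bs @ [3]"

definition enc_params :: "nat \<Rightarrow> nat \<Rightarrow> nat \<Rightarrow> nat list" where
  "enc_params k q Q = enc_bits (replicate k True) @ enc_bits (bits Q (int q))"

definition enc_vec :: "nat \<Rightarrow> int vec \<Rightarrow> nat list" where
  "enc_vec Q x = enc_bits (vec_bits Q x)"

definition enc_mat :: "nat \<Rightarrow> int mat \<Rightarrow> nat list" where
  "enc_mat Q A = concat (map (enc_vec Q) (rows A))"

text \<open>
  \<open>GenTrap k\<close> is the output distribution of a polynomial time computation \<open>g\<close> from the security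
  parameter \<open>k\<close> and polynomially many fair coins \<open>r\<close>.
\<close>

definition ppt_gen ::
  "(nat \<Rightarrow> nat) \<Rightarrow> (nat \<Rightarrow> nat) \<Rightarrow> (nat \<Rightarrow> (int mat \<times> bool list) pmf) \<Rightarrow> bool" where
  "ppt_gen q Q GenTrap \<longleftrightarrow>
     (\<exists>(p :: nat poly) (g :: nat \<Rightarrow> bool list \<Rightarrow> int mat \<times> bool list).
        (\<forall>k\<ge>1. GenTrap k = map_pmf (g k) (pmf_of_set {r. length r = poly p k})) \<and>
        polytime {(k, r). 1 \<le> k \<and> length r = poly p k}
          (\<lambda>(k, r). enc_params k (q k) (Q k) @ enc_bits r)
          (\<lambda>(k, r). case g k r of (A, t) \<Rightarrow> enc_mat (Q k) A @ enc_bits t))"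

definition polytime_inv ::
  "(nat \<Rightarrow> nat) \<Rightarrow> (nat \<Rightarrow> nat) \<Rightarrow> (nat \<Rightarrow> nat) \<Rightarrow> (nat \<Rightarrow> nat) \<Rightarrow>
   (nat \<Rightarrow> int mat \<Rightarrow> int vec \<Rightarrow> bool list \<Rightarrow> int vec) \<Rightarrow> bool" where
  "polytime_inv n m q Q Invert \<longleftrightarrow>
     polytime {(k, A, y, t). 1 \<le> k \<and> A \<in> Zmat (q k) (m k) (n k) \<and> y \<in> Zvec (q k) (m k)}
       (\<lambda>(k, A, y, t). enc_params k (q k) (Q k) @ enc_mat (Q k) A @ enc_vec (Q k) y @ enc_bits t)
       (\<lambda>(k, A, y, t). enc_vec (Q k) (Invert k A y t))"

end

theory Submission
  imports Defs "HOL-Number_Theory.Cong"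
begin

text \<open>
  Given the response \<open>y\<close>, the trapdoor property leaves at most the two_branch honest_support states
  \<open>|[x\<^sub>0]\<rangle>|0\<rangle>\<close> and \<open>|[x\<^sub>1]\<rangle>|1\<rangle>\<close>, and if both occur then \<open>x\<^sub>1 = x\<^sub>0 + s\<close>. Measuring a qubit of the first
  register in the XY-plane at angle \<open>r\<close> gives a uniform outcome and only changes the relative phase of
  the two_branch branches, by \<open>e\<^sup>-\<^sup>i\<^sup>r\<close> for a set bit and by a sign that ends up in \<open>d\<close>. The angles add up to
  \<open>2\<pi> a \<bullet> s / q\<close>, so after the phase gate the qubit \<open>L\<close> carries the phase
  \<open>2\<pi> (f \<bullet> e + b\<lfloor>q/4\<rfloor>) / q\<close>, which is close to \<open>b\<pi>/2\<close>, and the last measurement wins the CHSH-like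
  game with probability close to \<open>cos\<^sup>2 (\<pi>/8)\<close>. If only one branch occurs, the success
  probability is \<open>1/2\<close>; a union bound over the coordinates of \<open>e\<close> shows that this has probability at most
  \<open>\<Sum>|e\<^sub>i| / (2\<lfloor>\<tau>\<rfloor>+1)\<close>. Both losses are linear in \<open>\<Sum>|e\<^sub>i|\<close>, and \<open>E|e\<^sub>i| \<le> 4\<sigma>/3\<close> makes them smaller than
  \<open>m\<sigma>/(2\<tau>)\<close> already.
\<close>

section \<open>Measuring the qubits of a two_branch-branch state\<close>

lemma embed_pmf_pmf [simp]: "embed_pmf (pmf p) = p"
  by (rule type_definition.Rep_inverse[OF td_pmf_embed_pmf])

text \<open>\<open>embed_pmf\<close> is meaningful only for weights of total mass 1. Recognizing the
  weights as those of an existing \<open>p\<close> settles this and evaluates the measurement at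
  once.\<close>

lemma measurement_eq:
  assumes "\<And>u. norm_sq (K u \<psi>) = pmf p u"
  shows "measurement K \<psi> = map_pmf (\<lambda>u. (u, normalize_state (K u \<psi>))) p"
proof -
  have "(\<lambda>u. norm_sq (K u \<psi>)) = pmf p" using assms by auto
  then show ?thesis by (simp add: measurement_def)
qed

lemma norm_sq_superset:
  assumes "finite S" "\<And>b. b \<notin> S \<Longrightarrow> \<psi> b = 0"
  shows "norm_sq \<psi> = (\<Sum>b\<in>S. (cmod (\<psi> b))\<^sup>2)"
  unfolding norm_sq_def by (rule sum.mono_neutral_left) (use assms in auto)

lemma norm_sq_nonneg: "norm_sq \<psi> \<ge> 0"
  unfolding norm_sq_def by (intro sum_nonneg) auto

lemma map_fst_measurement_bool:
  assumes "norm_sq (K False \<psi>) + norm_sq (K True \<psi>) = 1"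
  shows "map_pmf fst (measurement K \<psi>) = bernoulli_pmf (norm_sq (K True \<psi>))"
proof -
  have "norm_sq (K u \<psi>) = pmf (bernoulli_pmf (norm_sq (K True \<psi>))) u" for u
    using assms norm_sq_nonneg[of "K False \<psi>"] norm_sq_nonneg[of "K True \<psi>"] by (cases u) auto
  from measurement_eq[of K \<psi>, OF this] show ?thesis
    by (simp add: pmf.map_comp o_def)
qed

text \<open>A measured qubit is kept as a product factor in front of the register instead of being
  discarded, so that the positions of the other qubits stay valid up to \<open>Suc\<close>. A label
  of such a product is never empty, hence the value 0 there.\<close>

definition tensor_qubit :: "(bool \<Rightarrow> complex) \<Rightarrow> bool list state \<Rightarrow> bool list state" where
  "tensor_qubit w \<phi> = (\<lambda>b. case b of [] \<Rightarrow> 0 | c # b' \<Rightarrow> w c * \<phi> b')"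

lemma tensor_qubit_simps [simp]: "tensor_qubit w \<phi> [] = 0" "tensor_qubit w \<phi> (c # b) = w c * \<phi> b"
  by (simp_all add: tensor_qubit_def)

abbreviation qubit_normalized :: "(bool \<Rightarrow> complex) \<Rightarrow> bool" where
  "qubit_normalized w \<equiv> (cmod (w False))\<^sup>2 + (cmod (w True))\<^sup>2 = 1"

lemma norm_sq_tensor_qubit:
  assumes "qubit_normalized w"
  shows "norm_sq (tensor_qubit w \<phi>) = norm_sq \<phi>"
proof (cases "finite {b. \<phi> b \<noteq> 0}")
  case True
  define S where "S = {b. \<phi> b \<noteq> 0}"
  define h :: "bool \<times> bool list \<Rightarrow> bool list" where "h = (\<lambda>(c, b). c # b)"
  have inj: "inj_on h (UNIV \<times> S)" by (auto simp: h_def inj_on_def)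
  have "norm_sq (tensor_qubit w \<phi>) = (\<Sum>b\<in>h ` (UNIV \<times> S). (cmod (tensor_qubit w \<phi> b))\<^sup>2)"
  proof (rule norm_sq_superset)
    fix b assume "b \<notin> h ` (UNIV \<times> S)"
    then show "tensor_qubit w \<phi> b = 0" by (cases b) (auto simp: h_def S_def image_iff)
  qed (use True S_def in auto)
  also have "\<dots> = (\<Sum>c\<in>UNIV. \<Sum>b\<in>S. (cmod (w c))\<^sup>2 * (cmod (\<phi> b))\<^sup>2)"
    by (subst sum.reindex[OF inj])
      (auto simp: sum.cartesian_product h_def norm_mult power_mult_distrib intro!: sum.cong)
  also have "\<dots> = norm_sq \<phi>"
    using assms by (simp add: UNIV_bool norm_sq_def S_def flip: sum_distrib_left distrib_right)
  finally show ?thesis .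
next
  case False
  \<comment> \<open>With infinite support, \<open>norm_sq\<close> is a sum over an infinite set and
    hence 0 by convention. A nonzero amplitude of \<open>w\<close> carries the infinite support over
    to the product, so both sides are 0.\<close>
  obtain c where c: "w c \<noteq> 0" using assms by (metis norm_zero power_zero_numeral add_0 zero_neq_one)
  have "(#) c ` {b. \<phi> b \<noteq> 0} \<subseteq> {b. tensor_qubit w \<phi> b \<noteq> 0}" using c by auto
  moreover have "infinite ((#) c ` {b. \<phi> b \<noteq> 0})"
    using False by (simp add: finite_image_iff)
  ultimately have "infinite {b. tensor_qubit w \<phi> b \<noteq> 0}" using finite_subset by blast
  then show ?thesis using False by (simp add: norm_sq_def)
qed

lemma normalize_tensor_qubit:
  assumes "qubit_normalized w"
  shows "normalize_state (tensor_qubit w \<phi>) = tensor_qubit w (normalize_state \<phi>)"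
  unfolding normalize_state_def norm_sq_tensor_qubit[OF assms]
  by (rule ext, rename_tac b, case_tac b) auto

lemma project_qubit_tensor_qubit:
  "project_qubit v (Suc k) (tensor_qubit w \<phi>) = tensor_qubit w (project_qubit v k \<phi>)"
proof
  fix b show "project_qubit v (Suc k) (tensor_qubit w \<phi>) b = tensor_qubit w (project_qubit v k \<phi>) b"
    by (cases b) (auto simp: project_qubit_def UNIV_bool algebra_simps)
qed

lemma phase_gate_tensor_qubit: "phase_gate \<theta> (Suc k) (tensor_qubit w \<phi>) = tensor_qubit w (phase_gate \<theta> k \<phi>)"
proof
  fix b show "phase_gate \<theta> (Suc k) (tensor_qubit w \<phi>) b = tensor_qubit w (phase_gate \<theta> k \<phi>) b"
    by (cases b) (auto simp: phase_gate_def)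
qed

lemma measure_qubit_tensor_qubit:
  assumes "qubit_normalized w"
  shows "measure_qubit M (Suc k) (tensor_qubit w \<phi>) = map_pmf (map_prod id (tensor_qubit w)) (measure_qubit M k \<phi>)"
  by (simp add: measure_qubit_def measurement_def project_qubit_tensor_qubit norm_sq_tensor_qubit normalize_tensor_qubit assms
      pmf.map_comp o_def)

text \<open>A qubit in a product with the rest is not affected by measurements of the rest, so it is
  carried along as an inert factor.\<close>

lemma measure_qubits_tensor_qubit:
  assumes "qubit_normalized w"
  shows "measure_qubits (map (map_prod Suc id) ks) (tensor_qubit w \<phi>) =
    map_pmf (map_prod id (tensor_qubit w)) (measure_qubits ks \<phi>)"
proof (induction ks arbitrary: \<phi>)
  case Nil
  then show ?case by simp
next
  case (Cons k ks)
  obtain k' M where k: "k = (k', M)" by (cases k)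
  show ?case
    by (simp add: k measure_qubit_tensor_qubit[OF assms] bind_map_pmf map_bind_pmf case_prod_unfold
        Cons.IH[unfolded id_def])
qed

section \<open>Superpositions of two basis states\<close>

definition two_branch :: "complex \<Rightarrow> complex \<Rightarrow> bool list \<Rightarrow> bool list \<Rightarrow> bool list state" where
  "two_branch \<alpha> \<beta> X Y = (\<lambda>b. \<alpha> * ket X b + \<beta> * ket Y b)"

text \<open>Pairing a branch with \<open>v\<close> gives the factor
  \<open>cnj (v $ of_bool x)\<close>, and the measured qubit ends in state \<open>v\<close> in both
  branches. It is thus no longer entangled with the rest, and two branches remain on a shorter
  register.\<close>

lemma project_qubit_two_branch:
  "project_qubit v 0 (two_branch \<alpha> \<beta> (x # X) (y # Y)) =
    tensor_qubit (\<lambda>c. v $ of_bool c) (two_branch (\<alpha> * cnj (v $ of_bool x)) (\<beta> * cnj (v $ of_bool y)) X Y)"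
proof
  fix b
  show "project_qubit v 0 (two_branch \<alpha> \<beta> (x # X) (y # Y)) b =
    tensor_qubit (\<lambda>c. v $ of_bool c) (two_branch (\<alpha> * cnj (v $ of_bool x)) (\<beta> * cnj (v $ of_bool y)) X Y) b"
    by (cases b; cases x; cases y) (auto simp: project_qubit_def two_branch_def ket_def UNIV_bool algebra_simps)
qed

lemma norm_sq_two_branch:
  assumes "X \<noteq> Y"
  shows "norm_sq (two_branch \<alpha> \<beta> X Y) = (cmod \<alpha>)\<^sup>2 + (cmod \<beta>)\<^sup>2"
  by (subst norm_sq_superset[of "{X, Y}"]) (use assms in \<open>auto simp: two_branch_def ket_def\<close>)

text \<open>Branches with the same label interfere. This happens once \<open>L\<close> itself has
  been projected and nothing distinguishes them any more.\<close>

lemma norm_sq_two_branch_same: "norm_sq (two_branch \<alpha> \<beta> X X) = (cmod (\<alpha> + \<beta>))\<^sup>2"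
  by (subst norm_sq_superset[of "{X}"]) (auto simp: two_branch_def ket_def)

lemma normalize_two_branch:
  assumes "X \<noteq> Y"
  shows "normalize_state (two_branch \<alpha> \<beta> X Y) =
    two_branch (\<alpha> / sqrt ((cmod \<alpha>)\<^sup>2 + (cmod \<beta>)\<^sup>2)) (\<beta> / sqrt ((cmod \<alpha>)\<^sup>2 + (cmod \<beta>)\<^sup>2)) X Y"
  unfolding normalize_state_def norm_sq_two_branch[OF assms]
  by (simp add: two_branch_def add_divide_distrib)

lemma phase_gate_two_branch:
  "phase_gate \<theta> 0 (two_branch \<alpha> \<beta> [False] [True]) = two_branch \<alpha> (cis \<theta> * \<beta>) [False] [True]"
  by (rule ext) (auto simp: phase_gate_def two_branch_def ket_def)

section \<open>Eigenvectors of the observables in the XY-plane, and single measurements\<close>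

lemma xy_obs_mult_vec:
  assumes "dim_vec v = 2"
  shows "xy_obs r *\<^sub>v v = vec_of_list [cis (- r) * v $ 1, cis r * v $ 0]"
proof -
  have [simp]: "dim_row pauli_X = 2" "dim_row pauli_Y = 2" "dim_col pauli_X = 2" "dim_col pauli_Y = 2"
    by (auto simp: pauli_X_def pauli_Y_def mat_of_rows_list_def)
  have c: "cis r = complex_of_real (cos r) + \<i> * complex_of_real (sin r)"
    "cis (- r) = complex_of_real (cos r) - \<i> * complex_of_real (sin r)"
    by (simp_all add: complex_eq_iff)
  have [simp]: "row (xy_obs r) i = vec 2 (\<lambda>j. xy_obs r $$ (i, j))" if "i < 2" for i
    using that by (simp add: row_def xy_obs_def)
  have e: "xy_obs r $$ (0, 0) = 0" "xy_obs r $$ (1, 1) = 0"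
    "xy_obs r $$ (0, 1) = cis (- r)" "xy_obs r $$ (1, 0) = cis r"
    by (simp_all add: xy_obs_def c pauli_X_def pauli_Y_def mat_of_rows_list_def)
  show ?thesis
  proof (rule eq_vecI)
    fix i assume "i < dim_vec (vec_of_list [cis (- r) * v $ 1, cis r * v $ 0])"
    then have i: "i = 0 \<or> i = 1" by auto
    then have [simp]: "i < 2" by auto
    have [simp]: "dim_row (xy_obs r) = 2" by (simp add: xy_obs_def)
    have "(xy_obs r *\<^sub>v v) $ i = xy_obs r $$ (i, 0) * v $ 0 + xy_obs r $$ (i, 1) * v $ 1"
      using assms by (simp add: scalar_prod_def atLeast0LessThan lessThan_nat_numeral lessThan_Suc)
    then show "(xy_obs r *\<^sub>v v) $ i = vec_of_list [cis (- r) * v $ 1, cis r * v $ 0] $ i"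
      using i e by auto
  qed (simp add: xy_obs_def)
qed

text \<open>Existence comes first, for \<open>SOME\<close> to deliver an eigenvector at all. The
  eigenvalue equation then ties entry 1 to entry 0, and the norm fixes the modulus. The phase of
  entry 0 stays unknown, so both conclusions are independent of it.\<close>

lemma unit_eigenvector_xy_obs:
  fixes r :: real and u :: bool
  defines "v \<equiv> unit_eigenvector (xy_obs r) ((-1) ^ of_bool u)"
  shows "v $ 0 * cnj (v $ 0) = 1 / 2" "v $ 1 = (-1) ^ of_bool u * cis r * v $ 0"
proof -
  have dim: "dim_row (xy_obs r) = 2"
    by (simp add: xy_obs_def pauli_Y_def mat_of_rows_list_def)
  define \<mu> :: complex where "\<mu> = (-1) ^ of_bool u"
  have \<mu>: "\<mu> * \<mu> = 1" "cnj \<mu> = \<mu>" by (auto simp: \<mu>_def)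
  \<comment> \<open>The standard eigenvector serves as a witness of existence only; \<open>v\<close>
    may differ from it by a phase.\<close>
  define z where "z = vec_of_list [complex_of_real (1 / sqrt 2), \<mu> * cis r * complex_of_real (1 / sqrt 2)]"
  have z: "dim_vec z = 2" "z $ 0 = complex_of_real (1 / sqrt 2)"
    "z $ 1 = \<mu> * cis r * complex_of_real (1 / sqrt 2)"
    by (auto simp: z_def)
  have cc: "cis (-r) * cis r = 1" by (simp add: cis_mult)
  have ev: "xy_obs r *\<^sub>v z = \<mu> \<cdot>\<^sub>v z"
    unfolding xy_obs_mult_vec[OF z(1)] using z \<mu> cc
    by (intro eq_vecI) (auto simp: less_2_cases_iff vec_of_list_index nth_Cons' z algebra_simps)
  have sp: "w \<bullet>c w = w $ 0 * cnj (w $ 0) + w $ 1 * cnj (w $ 1)" if "dim_vec w = 2" for w :: "complex vec"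
    using that by (simp add: scalar_prod_def numeral_2_eq_2)
  have half: "complex_of_real (1 / sqrt 2) * cnj (complex_of_real (1 / sqrt 2)) = 1 / 2"
    by (simp flip: of_real_mult)
  have "z \<bullet>c z = 1"
    unfolding sp[OF z(1)] z using \<mu> cc half by (simp add: cis_cnj) (simp add: algebra_simps)
  moreover have "z \<noteq> 0\<^sub>v 2"
    using z(2) by (auto dest!: arg_cong[where f="\<lambda>v. v $ 0"])
  ultimately have "eigenvector (xy_obs r) z \<mu> \<and> z \<bullet>c z = 1"
    using ev z(1) by (auto simp: eigenvector_def dim intro: carrier_vecI)
  then have "eigenvector (xy_obs r) v \<mu> \<and> v \<bullet>c v = 1"
    unfolding v_def unit_eigenvector_def \<mu>_def[symmetric] by (rule someI)
  then have v: "dim_vec v = 2" "xy_obs r *\<^sub>v v = \<mu> \<cdot>\<^sub>v v" "v \<bullet>c v = 1"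
    by (auto simp: eigenvector_def dim)
  have "cis r * v $ 0 = \<mu> * v $ 1"
    using arg_cong[OF v(2)[unfolded xy_obs_mult_vec[OF v(1)]], where f="\<lambda>v. v $ 1"] v(1) by simp
  then have "\<mu> * (cis r * v $ 0) = \<mu> * \<mu> * v $ 1" by simp
  then have v1: "v $ 1 = \<mu> * cis r * v $ 0" using \<mu> by (simp add: mult.assoc)
  then show "v $ 1 = (-1) ^ of_bool u * cis r * v $ 0" by (simp add: \<mu>_def)
  have "1 = v $ 0 * cnj (v $ 0) + v $ 1 * cnj (v $ 1)" using sp[OF v(1)] v(3) by simp
  also have "v $ 1 * cnj (v $ 1) = (\<mu> * \<mu>) * (cis (-r) * cis r) * (v $ 0 * cnj (v $ 0))"
    unfolding v1 using \<mu> by (simp add: cis_cnj)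
  finally show "v $ 0 * cnj (v $ 0) = 1 / 2" using \<mu> cc by (simp add: mult.commute)
qed

text \<open>These products are the entries of the projection, in which the unknown phase cancels.
  The outcome \<open>u\<close> enters only as a sign of the off-diagonal entries.\<close>

lemma unit_eigenvector_xy_obs_mult_cnj:
  fixes r :: real and u x y :: bool
  defines "v \<equiv> unit_eigenvector (xy_obs r) ((-1) ^ of_bool u)"
  shows "v $ of_bool x * cnj (v $ of_bool y) =
    (-1) ^ of_bool (u \<and> x \<noteq> y) * cis (r * (of_bool x - of_bool y)) / 2"
proof -
  note v = unit_eigenvector_xy_obs[of r u, folded v_def]
  have "v $ of_bool x = ((-1) ^ of_bool u * cis r) ^ of_bool x * v $ 0" for x
    using v(2) by (cases x) auto
  then have "v $ of_bool x * cnj (v $ of_bool y) =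
    ((-1) ^ of_bool u * cis r) ^ of_bool x * cnj (((-1) ^ of_bool u * cis r) ^ of_bool y) * (v $ 0 * cnj (v $ 0))"
    by (simp add: mult_ac)
  also have "\<dots> = (-1) ^ of_bool (u \<and> x \<noteq> y) * cis (r * (of_bool x - of_bool y)) / 2"
    unfolding v(1) by (cases x; cases y; cases u) (auto simp: cis_cnj cis_mult)
  finally show ?thesis .
qed

lemma cmod_unit_eigenvector_xy_obs:
  "(cmod (unit_eigenvector (xy_obs r) ((-1) ^ of_bool u) $ of_bool x))\<^sup>2 = 1 / 2"
proof -
  have "complex_of_real ((cmod (unit_eigenvector (xy_obs r) ((-1) ^ of_bool u) $ of_bool x))\<^sup>2) = 1 / 2"
    unfolding complex_norm_square unit_eigenvector_xy_obs_mult_cnj by simp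
  then show ?thesis by (metis Re_complex_of_real Re_divide_numeral one_complex.simps(1))
qed

text \<open>Both entries of either eigenvector have squared modulus 1/2, so each branch keeps half
  of its weight whatever its bit and the outcome are. Hence the outcome is a fair coin and
  renormalization contributes \<open>sqrt 2\<close>.\<close>

lemma measure_qubit_two_branch:
  fixes r :: real and \<alpha> \<beta> :: complex
  assumes "(cmod \<alpha>)\<^sup>2 + (cmod \<beta>)\<^sup>2 = 1" "X \<noteq> Y"
  defines "v \<equiv> \<lambda>u. unit_eigenvector (xy_obs r) ((-1) ^ of_bool u)"
  shows "measure_qubit (xy_obs r) 0 (two_branch \<alpha> \<beta> (x # X) (y # Y)) =
    map_pmf (\<lambda>u. (u, tensor_qubit (\<lambda>c. v u $ of_bool c)
      (two_branch (sqrt 2 * \<alpha> * cnj (v u $ of_bool x)) (sqrt 2 * \<beta> * cnj (v u $ of_bool y)) X Y))) coin"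
proof -
  have w: "qubit_normalized (\<lambda>c. v u $ of_bool c)" for u
    using cmod_unit_eigenvector_xy_obs[of r u False] cmod_unit_eigenvector_xy_obs[of r u True]
    unfolding v_def by simp
  have s: "(cmod (\<alpha> * cnj (v u $ of_bool x)))\<^sup>2 + (cmod (\<beta> * cnj (v u $ of_bool y)))\<^sup>2 = 1 / 2" for u
    using assms(1) unfolding norm_mult power_mult_distrib complex_mod_cnj v_def cmod_unit_eigenvector_xy_obs
    by (simp flip: add_divide_distrib)
  have c: "pmf coin u = 1 / 2" for u by (simp add: coin_def)
  have v: "unit_eigenvector (xy_obs r) ((-1) ^ of_bool u) = v u" for u
    by (simp add: v_def)
  have nrm: "norm_sq (project_qubit (v u) 0 (two_branch \<alpha> \<beta> (x # X) (y # Y))) = pmf coin u" for u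
    unfolding project_qubit_two_branch norm_sq_tensor_qubit[OF w] norm_sq_two_branch[OF assms(2)] s c ..
  have d: "z / complex_of_real (sqrt (1 / 2)) = sqrt 2 * z" for z :: complex
    by (simp add: real_sqrt_divide)
  have st: "normalize_state (project_qubit (v u) 0 (two_branch \<alpha> \<beta> (x # X) (y # Y))) =
    tensor_qubit (\<lambda>c. v u $ of_bool c)
      (two_branch (sqrt 2 * \<alpha> * cnj (v u $ of_bool x)) (sqrt 2 * \<beta> * cnj (v u $ of_bool y)) X Y)" for u
    unfolding project_qubit_two_branch normalize_tensor_qubit[OF w] normalize_two_branch[OF assms(2)] s d mult.assoc ..
  show ?thesis
    unfolding measure_qubit_def v st[symmetric]
    by (rule measurement_eq) (rule nrm)
qed

lemma cmod_add_squared: "(cmod (a + b))\<^sup>2 = (cmod a)\<^sup>2 + (cmod b)\<^sup>2 + 2 * Re (cnj a * b)"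
  unfolding cmod_power2 by (simp add: algebra_simps power2_eq_square)

text \<open>Nothing but \<open>L\<close> distinguishes the branches here, so projecting it makes
  them interfere. The bias of the outcome is governed by the relative phase in
  \<open>cnj \<alpha> * \<beta>\<close>.\<close>

lemma measure_qubit_two_branch_final:
  assumes "(cmod \<alpha>)\<^sup>2 + (cmod \<beta>)\<^sup>2 = 1"
  shows "pmf (map_pmf fst (measure_qubit (xy_obs \<xi>) 0 (two_branch \<alpha> \<beta> [False] [True]))) u =
    1 / 2 + (-1) ^ of_bool u * Re (cnj \<alpha> * \<beta> * cis (- \<xi>))"
proof -
  define v where "v = (\<lambda>u. unit_eigenvector (xy_obs \<xi>) ((-1) ^ of_bool u))"
  have w: "qubit_normalized (\<lambda>c. v u $ of_bool c)" for u
    using cmod_unit_eigenvector_xy_obs[of \<xi> u False] cmod_unit_eigenvector_xy_obs[of \<xi> u True]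
    unfolding v_def by simp
  have p: "norm_sq (project_qubit (v u) 0 (two_branch \<alpha> \<beta> [False] [True])) =
      1 / 2 + (-1) ^ of_bool u * Re (cnj \<alpha> * \<beta> * cis (- \<xi>))" for u
  proof -
    have "norm_sq (project_qubit (v u) 0 (two_branch \<alpha> \<beta> [False] [True])) =
        (cmod (\<alpha> * cnj (v u $ of_bool False) + \<beta> * cnj (v u $ of_bool True)))\<^sup>2"
      by (simp only: project_qubit_two_branch norm_sq_tensor_qubit[OF w] norm_sq_two_branch_same)
    also have "\<dots> = (cmod (\<alpha> * cnj (v u $ of_bool False)))\<^sup>2 + (cmod (\<beta> * cnj (v u $ of_bool True)))\<^sup>2
        + 2 * Re (cnj (\<alpha> * cnj (v u $ of_bool False)) * (\<beta> * cnj (v u $ of_bool True)))"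
      by (rule cmod_add_squared)
    also have "\<dots> = 1 / 2 + 2 * Re (cnj (\<alpha> * cnj (v u $ of_bool False)) * (\<beta> * cnj (v u $ of_bool True)))"
      using assms unfolding norm_mult power_mult_distrib complex_mod_cnj v_def cmod_unit_eigenvector_xy_obs
      by (simp flip: add_divide_distrib)
    also have "cnj (\<alpha> * cnj (v u $ of_bool False)) * (\<beta> * cnj (v u $ of_bool True)) =
        cnj \<alpha> * \<beta> * (v u $ of_bool False * cnj (v u $ of_bool True))"
      by simp
    also have "\<dots> = (-1) ^ of_bool u * (cnj \<alpha> * \<beta> * cis (- \<xi>)) / 2"
      unfolding v_def unit_eigenvector_xy_obs_mult_cnj by simp
    also have "2 * Re ((-1) ^ of_bool u * z / 2) = (-1) ^ of_bool u * Re z" for z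
      by (cases u) auto
    finally show ?thesis .
  qed
  define K where "K = (\<lambda>u. project_qubit (v u) 0)"
  have eq: "map_pmf fst (measure_qubit (xy_obs \<xi>) 0 (two_branch \<alpha> \<beta> [False] [True])) =
      bernoulli_pmf (norm_sq (K True (two_branch \<alpha> \<beta> [False] [True])))"
    unfolding measure_qubit_def K_def v_def
    by (rule map_fst_measurement_bool) (simp only: p[unfolded v_def], simp)
  have "0 \<le> norm_sq (K True (two_branch \<alpha> \<beta> [False] [True]))" "0 \<le> norm_sq (K False (two_branch \<alpha> \<beta> [False] [True]))"
    by (rule norm_sq_nonneg)+
  then show ?thesis unfolding eq unfolding K_def p by (cases u) auto
qed

section \<open>The sequence of measurements as a game\<close>

lemma bdot_Cons: "bdot (u # us) (z # zs) \<longleftrightarrow> (u \<and> z) \<noteq> bdot us zs"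
  unfolding bdot_def by (auto simp: sum.lessThan_Suc_shift simp del: sum.lessThan_Suc sum_of_bool_eq)

lemma bxor_Cons: "bxor (x # xs) (y # ys) = (x \<noteq> y) # bxor xs ys"
  by (simp add: bxor_def)

lemma zip_upt_Suc:
  "zip [0..<length (r # rs)] (map f (r # rs)) = (0, f r) # map (map_prod Suc id) (zip [0..<length rs] (map f rs))"
proof -
  have "[0..<length (r # rs)] = 0 # map Suc [0..<length rs]"
    by (simp add: upt_conv_Cons map_Suc_upt del: upt_Suc)
  then show ?thesis by (simp add: zip_map1 map_prod_def id_def)
qed

lemma pmf_bind_coin: "pmf (bind_pmf coin f) x = (pmf (f False) x + pmf (f True) x) / 2"
  by (simp add: coin_def pmf_bind_pmf_of_set UNIV_bool)

text \<open>Induction over the qubits, with the amplitudes and the target \<open>S\<close>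
  arbitrary. Measuring a qubit gives a fair coin \<open>u\<close> and multiplies
  \<open>cnj \<alpha> * \<beta>\<close> by a phase and by a sign, negative iff
  \<open>u \<and> x \<noteq> y\<close>. The same bit is added to the inner product, where it toggles
  \<open>S\<close>; the two signs cancel and every outcome leads to the same probability. The last
  bits \<open>False\<close> and \<open>True\<close> keep the branches distinct until
  \<open>L\<close> is measured.\<close>

lemma qubit_game:
  assumes "length xs = length rs" "length ys = length rs" "(cmod \<alpha>)\<^sup>2 + (cmod \<beta>)\<^sup>2 = 1"
  shows "pmf (measure_qubits (zip [0..<length rs] (map xy_obs rs)) (two_branch \<alpha> \<beta> (xs @ [False]) (ys @ [True])) \<bind>
      (\<lambda>(us, \<psi>). map_pmf (\<lambda>d. (bdot us (bxor xs ys) \<noteq> d) \<longleftrightarrow> S)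
        (map_pmf fst (measure_qubit (xy_obs \<xi>) (length rs) (phase_gate \<theta> (length rs) \<psi>))))) True =
    1 / 2 + (-1) ^ of_bool S * Re (cnj \<alpha> * \<beta> *
      cis (\<theta> - \<xi> - (\<Sum>(r, x, y)\<leftarrow>zip rs (zip xs ys). r * (of_bool y - of_bool x))))"
  using assms
proof (induction rs arbitrary: xs ys \<alpha> \<beta> S)
  case Nil
  have n: "(cmod \<alpha>)\<^sup>2 + (cmod (cis \<theta> * \<beta>))\<^sup>2 = 1" using Nil by (simp add: norm_mult)
  \<comment> \<open>With no qubits left the inner product is 0, so winning means that the outcome on
    \<open>L\<close> equals \<open>S\<close>.\<close>
  have "(\<lambda>d. (bdot [] (bxor xs ys) \<noteq> d) \<longleftrightarrow> S) -` {True} = {S}"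
    by (auto simp: bdot_def)
  then have P: "pmf (map_pmf (\<lambda>d. (bdot [] (bxor xs ys) \<noteq> d) \<longleftrightarrow> S) P) True = pmf P S" for P
    by (simp add: pmf_map measure_pmf_single)
  have E: "cnj \<alpha> * (cis \<theta> * \<beta>) * cis (- \<xi>) = cnj \<alpha> * \<beta> * cis (\<theta> - \<xi>)"
    using cis_mult[of \<theta> "- \<xi>"] by (simp add: mult_ac)
  show ?case
    using P Nil measure_qubit_two_branch_final[OF n, of \<xi> S, unfolded E]
    by (simp add: bind_return_pmf phase_gate_two_branch del: map_pmf_comp)
next
  case (Cons r rs)
  obtain x xs' y ys' where xs: "xs = x # xs'" and ys: "ys = y # ys'"
    using Cons.prems by (cases xs; cases ys) auto
  have len: "length xs' = length rs" "length ys' = length rs" using Cons.prems xs ys by auto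
  define v where "v = (\<lambda>u. unit_eigenvector (xy_obs r) ((-1) ^ of_bool u))"
  define \<alpha>' where "\<alpha>' = (\<lambda>u. sqrt 2 * \<alpha> * cnj (v u $ of_bool x))"
  define \<beta>' where "\<beta>' = (\<lambda>u. sqrt 2 * \<beta> * cnj (v u $ of_bool y))"
  define W where "W = (\<lambda>u c. v u $ of_bool c)"
  have w: "qubit_normalized (W u)" for u
    using cmod_unit_eigenvector_xy_obs[of r u False] cmod_unit_eigenvector_xy_obs[of r u True]
    unfolding W_def v_def by simp
  have n: "(cmod (\<alpha>' u))\<^sup>2 + (cmod (\<beta>' u))\<^sup>2 = 1" for u
    using Cons.prems(3) unfolding \<alpha>'_def \<beta>'_def norm_mult power_mult_distrib
      complex_mod_cnj v_def cmod_unit_eigenvector_xy_obs by simp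
  have neq: "xs' @ [False] \<noteq> ys' @ [True]" by simp
  define T where "T = (\<Sum>(r, x, y)\<leftarrow>zip rs (zip xs' ys'). r * (of_bool y - of_bool x) :: real)"
  \<comment> \<open>The game that remains after outcome \<open>u\<close>: the bit that
    \<open>u\<close> adds to the inner product has been moved into the target.\<close>
  define G where "G = (\<lambda>u. measure_qubits (zip [0..<length rs] (map xy_obs rs)) (two_branch (\<alpha>' u) (\<beta>' u) (xs' @ [False]) (ys' @ [True])) \<bind>
      (\<lambda>(us, \<psi>). map_pmf (\<lambda>d. (bdot us (bxor xs' ys') \<noteq> d) \<longleftrightarrow> (S \<noteq> (u \<and> x \<noteq> y)))
        (map_pmf fst (measure_qubit (xy_obs \<xi>) (length rs) (phase_gate \<theta> (length rs) \<psi>)))))"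
  have "pmf (G u) True = 1 / 2 + (-1) ^ of_bool S * Re (cnj \<alpha> * \<beta> * cis (\<theta> - \<xi> - (r * (of_bool y - of_bool x) + T)))" for u
  proof -
    have "cnj (\<alpha>' u) * \<beta>' u = 2 * (cnj \<alpha> * \<beta> * (v u $ of_bool x * cnj (v u $ of_bool y)))"
    proof -
      have "complex_of_real (sqrt 2) * complex_of_real (sqrt 2) = 2" by (simp flip: of_real_mult)
      moreover have "cnj (\<alpha>' u) * \<beta>' u = (complex_of_real (sqrt 2) * complex_of_real (sqrt 2)) *
          (cnj \<alpha> * \<beta> * (v u $ of_bool x * cnj (v u $ of_bool y)))"
        unfolding \<alpha>'_def \<beta>'_def complex_cnj_mult complex_cnj_cnj complex_cnj_complex_of_real
        by (simp only: mult_ac)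
      ultimately show ?thesis by simp
    qed
    also have "\<dots> = (-1) ^ of_bool (u \<and> x \<noteq> y) * (cnj \<alpha> * \<beta> * cis (r * (of_bool x - of_bool y)))"
      unfolding v_def unit_eigenvector_xy_obs_mult_cnj by simp
    finally have e: "cnj (\<alpha>' u) * \<beta>' u * cis t = (-1) ^ of_bool (u \<and> x \<noteq> y) *
        (cnj \<alpha> * \<beta> * cis (r * (of_bool x - of_bool y) + t))" for t
      by (simp add: mult_ac flip: cis_mult)
    have t: "r * (of_bool x - of_bool y) + (\<theta> - \<xi> - T) = \<theta> - \<xi> - (r * (of_bool y - of_bool x) + T)"
      by (simp add: algebra_simps)
    show ?thesis
      unfolding G_def Cons.IH[OF len n] T_def[symmetric] e t
      by (cases S; cases "u \<and> x \<noteq> y") auto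
  qed
  moreover have "measure_qubits (zip [0..<length (r # rs)] (map xy_obs (r # rs))) (two_branch \<alpha> \<beta> (xs @ [False]) (ys @ [True])) \<bind>
      (\<lambda>(us, \<psi>). map_pmf (\<lambda>d. (bdot us (bxor xs ys) \<noteq> d) \<longleftrightarrow> S)
        (map_pmf fst (measure_qubit (xy_obs \<xi>) (length (r # rs)) (phase_gate \<theta> (length (r # rs)) \<psi>)))) = bind_pmf coin G"
  proof -
    have b: "(((u \<and> x \<noteq> y) \<noteq> D) \<noteq> d) = S \<longleftrightarrow> (D \<noteq> d) = (S \<noteq> (u \<and> x \<noteq> y))" for u D d
      by auto
    have M2: "measure_qubit (xy_obs r) 0 (two_branch \<alpha> \<beta> (x # xs' @ [False]) (y # ys' @ [True])) =
        map_pmf (\<lambda>u. (u, tensor_qubit (W u) (two_branch (\<alpha>' u) (\<beta>' u) (xs' @ [False]) (ys' @ [True])))) coin"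
      unfolding \<alpha>'_def \<beta>'_def W_def v_def by (rule measure_qubit_two_branch[OF Cons.prems(3) neq])
    have D: "bdot (u # us) (bxor (x # xs') (y # ys')) \<longleftrightarrow> (u \<and> x \<noteq> y) \<noteq> bdot us (bxor xs' ys')" for u us
      unfolding bxor_Cons bdot_Cons ..
    define R where "R = (\<lambda>us \<psi>. map_pmf (\<lambda>d. (bdot us (bxor xs ys) \<noteq> d) \<longleftrightarrow> S)
        (map_pmf fst (measure_qubit (xy_obs \<xi>) (length (r # rs)) (phase_gate \<theta> (length (r # rs)) \<psi>))))"
    have R: "R (u # us) (tensor_qubit (W u) \<psi>) = map_pmf (\<lambda>d. (bdot us (bxor xs' ys') \<noteq> d) \<longleftrightarrow> (S \<noteq> (u \<and> x \<noteq> y)))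
        (map_pmf fst (measure_qubit (xy_obs \<xi>) (length rs) (phase_gate \<theta> (length rs) \<psi>)))" for u us \<psi>
      by (simp only: R_def xs ys D b length_Cons phase_gate_tensor_qubit measure_qubit_tensor_qubit[OF w] pmf.map_comp o_def
          fst_map_prod id_apply)
    have H: "measure_qubits (map (map_prod Suc id) ks) (tensor_qubit (W u) \<phi>) \<bind> (\<lambda>(us, \<psi>). R (u # us) \<psi>) =
        measure_qubits ks \<phi> \<bind> (\<lambda>(us, \<psi>). R (u # us) (tensor_qubit (W u) \<psi>))" for u ks \<phi>
      by (simp only: measure_qubits_tensor_qubit[OF w] bind_map_pmf case_prod_unfold fst_map_prod snd_map_prod id_apply)
    have "measure_qubits (zip [0..<length (r # rs)] (map xy_obs (r # rs))) (two_branch \<alpha> \<beta> (xs @ [False]) (ys @ [True])) \<bind>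
        (\<lambda>(us, \<psi>). R us \<psi>) =
        coin \<bind> (\<lambda>u. measure_qubits (map (map_prod Suc id) (zip [0..<length rs] (map xy_obs rs)))
          (tensor_qubit (W u) (two_branch (\<alpha>' u) (\<beta>' u) (xs' @ [False]) (ys' @ [True]))) \<bind> (\<lambda>(us, \<psi>). R (u # us) \<psi>))"
      unfolding zip_upt_Suc measure_qubits.simps xs ys append_Cons M2
      by (simp add: bind_map_pmf bind_assoc_pmf bind_return_pmf case_prod_unfold)
    then show ?thesis unfolding H R unfolding G_def R_def .
  qed
  ultimately show ?case
    by (simp only: pmf_bind_coin) (simp add: xs ys T_def)
qed

section \<open>Uniform superpositions and binary representations\<close>

lemma normalize_state_scale:
  assumes "c > 0"
  shows "normalize_state (\<lambda>b. \<psi> b * complex_of_real c) = normalize_state \<psi>"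
proof -
  have "norm_sq (\<lambda>b. \<psi> b * complex_of_real c) = norm_sq \<psi> * c\<^sup>2"
    using assms by (simp add: norm_sq_def norm_mult power_mult_distrib sum_distrib_right)
  then show ?thesis
    using assms by (simp add: normalize_state_def real_sqrt_mult)
qed

text \<open>The probability of \<open>y\<close> is proportional to the size of its slice of
  \<open>D\<close>, which is the law of the second component of a uniform element. The common
  amplitude disappears in the normalization. So the measurement can be replaced by classical
  sampling from \<open>D\<close>.\<close>

lemma measure_snd_uniform:
  assumes D: "finite D" "D \<noteq> {}"
  shows "measure_snd (\<lambda>z. of_bool (z \<in> D) * complex_of_real (1 / sqrt (real (card D)))) =
    map_pmf (\<lambda>(b, y). (y, normalize_state (\<lambda>b. of_bool ((b, y) \<in> D)))) (pmf_of_set D)"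
proof -
  define c where "c = 1 / sqrt (real (card D))"
  have c: "c > 0" "c\<^sup>2 = 1 / real (card D)"
    using D by (simp_all add: c_def card_gt_0_iff power_divide)
  have "norm_sq (\<lambda>b. of_bool ((b, y) \<in> D) * complex_of_real c) = pmf (map_pmf snd (pmf_of_set D)) y" for y
  proof -
    have fin: "finite {b. (b, y) \<in> D}"
      by (rule finite_subset[of _ "fst ` D"]) (use D in \<open>force+\<close>)
    have "norm_sq (\<lambda>b. of_bool ((b, y) \<in> D) * complex_of_real c) = (\<Sum>b | (b, y) \<in> D. c\<^sup>2)"
      using c by (subst norm_sq_superset[OF fin]) auto
    also have "\<dots> = real (card {b. (b, y) \<in> D}) / real (card D)"
      by (simp add: c)
    also have "card {b. (b, y) \<in> D} = card (D \<inter> snd -` {y})"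
      by (rule bij_betw_same_card[of "\<lambda>b. (b, y)"]) (auto simp: bij_betw_def inj_on_def)
    finally show ?thesis using D by (simp add: pmf_map measure_pmf_of_set)
  qed
  then show ?thesis
    unfolding measure_snd_def c_def[symmetric]
    by (subst measurement_eq[where p = "map_pmf snd (pmf_of_set D)"])
      (auto simp: normalize_state_scale[OF c(1)] pmf.map_comp o_def case_prod_unfold)
qed

text \<open>If only one label is present, the other amplitude is 0, so a collapsed state is covered
  by the two-branch analysis too. The value of \<open>cnj \<alpha> * \<beta>\<close> is all that the
  game depends on.\<close>

lemma normalize_indicator_two_branch:
  assumes S: "S \<subseteq> {X, Y}" "S \<noteq> {}" and XY: "X \<noteq> Y"
  obtains \<alpha> \<beta> where "normalize_state (\<lambda>b. of_bool (b \<in> S)) = two_branch \<alpha> \<beta> X Y"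
    "(cmod \<alpha>)\<^sup>2 + (cmod \<beta>)\<^sup>2 = 1" "cnj \<alpha> * \<beta> = of_bool (X \<in> S \<and> Y \<in> S) / 2"
proof -
  have nn: "norm_sq (two_branch (of_bool p) (of_bool p') X Y) = of_bool p + of_bool p'" for p p'
    unfolding norm_sq_two_branch[OF XY] by (cases p; cases p') auto
  have eq: "(\<lambda>b. of_bool (b \<in> S)) = two_branch (of_bool (X \<in> S)) (of_bool (Y \<in> S)) X Y"
    by (rule ext) (use S XY in \<open>auto simp: two_branch_def ket_def\<close>)
  have norm: "normalize_state (\<lambda>b. of_bool (b \<in> S)) =
     two_branch (of_bool (X \<in> S) / sqrt (of_bool (X \<in> S) + of_bool (Y \<in> S)))
       (of_bool (Y \<in> S) / sqrt (of_bool (X \<in> S) + of_bool (Y \<in> S))) X Y"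
    unfolding eq normalize_two_branch[OF XY] by (cases "X \<in> S"; cases "Y \<in> S") auto
  have s2: "complex_of_real (sqrt 2) * complex_of_real (sqrt 2) = 2" by (simp flip: of_real_mult)
  show ?thesis
    by (rule that[OF norm]; cases "X \<in> S"; cases "Y \<in> S")
      (use S in \<open>auto simp: norm_divide power_divide s2\<close>)
qed

section \<open>Binary representations\<close>

lemma length_vec_bits [simp]: "length (vec_bits Q x) = dim_vec x * Q"
proof -
  have "length (concat (map (bits Q) ys)) = length ys * Q" for ys
    by (induction ys) (auto simp: bits_def)
  then show ?thesis by (simp add: vec_bits_def)
qed

lemma sum_bit_eq:
  assumes "0 \<le> k" "k < 2 ^ Q"
  shows "(\<Sum>j<Q. of_bool (bit k j) * 2 ^ j) = (k :: int)"
proof -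
  have "take_bit Q k = k" using assms by (simp add: take_bit_int_eq_self)
  moreover have "horner_sum of_bool 2 (map (bit k) [0..<Q]) = (\<Sum>j<Q. of_bool (bit k j) * 2 ^ j :: int)"
    unfolding horner_sum_eq_sum by (rule sum.cong) (auto simp: lessThan_atLeast0)
  ultimately show ?thesis
    using horner_sum_bit_eq_take_bit[of k Q] by simp
qed

lemma Zvec_index:
  assumes "x \<in> Zvec q n" "i < n"
  shows "0 \<le> x $ i" "x $ i < int q"
  using assms by (auto simp: Zvec_def)

text \<open>All blocks have length \<open>Q\<close>, so the concatenation can be cut back into
  blocks, and \<open>Q\<close> bits determine a number below \<open>q \<le> 2 ^ Q\<close>.\<close>

lemma inj_on_vec_bits:
  assumes "q \<le> 2 ^ Q"
  shows "inj_on (vec_bits Q) (Zvec q n)"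
proof (rule inj_onI)
  fix x y assume x: "x \<in> Zvec q n" and y: "y \<in> Zvec q n" and eq: "vec_bits Q x = vec_bits Q y"
  have dim: "dim_vec x = n" "dim_vec y = n" using x y by (auto simp: Zvec_def)
  have "map (bits Q) (list_of_vec x) = map (bits Q) (list_of_vec y)"
    using eq dim unfolding vec_bits_def
    by (subst (asm) concat_eq_concat_iff) (auto simp: set_zip bits_def)
  then have b: "bits Q (x $ i) = bits Q (y $ i)" if "i < n" for i
    using that dim by (metis nth_map length_list_of_vec list_of_vec_index)
  have "x $ i = y $ i" if i: "i < n" for i
  proof -
    have "int q \<le> 2 ^ Q" using assms by (metis of_nat_le_iff of_nat_numeral of_nat_power)
    then have r: "0 \<le> x $ i" "x $ i < 2 ^ Q" "0 \<le> y $ i" "y $ i < 2 ^ Q"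
      using Zvec_index[OF x i] Zvec_index[OF y i] by linarith+
    have "bit (x $ i) j = bit (y $ i) j" if "j < Q" for j
      using b[OF i] that by (simp add: bits_def map_eq_conv)
    then have "(\<Sum>j<Q. of_bool (bit (x $ i) j) * 2 ^ j) = (\<Sum>j<Q. of_bool (bit (y $ i) j) * 2 ^ j :: int)"
      by (intro sum.cong) auto
    then show ?thesis
      using sum_bit_eq[OF r(1,2)] sum_bit_eq[OF r(3,4)] by simp
  qed
  then show "x = y" using dim by (intro eq_vecI) auto
qed

section \<open>Bob's angles and the phase that they accumulate\<close>

lemma zip_concat_map:
  assumes "\<And>i. i \<in> set l \<Longrightarrow> length (f i) = length (g i)"
  shows "zip (concat (map f l)) (concat (map g l)) = concat (map (\<lambda>i. zip (f i) (g i)) l)"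
  using assms by (induction l) auto

lemma sum_list_concat_map: "sum_list (map h (concat (map f l))) = (\<Sum>i\<leftarrow>l. \<Sum>x\<leftarrow>f i. h x)"
  for h :: "_ \<Rightarrow> 'a :: monoid_add"
  by (induction l) auto

definition bob_angles :: "nat \<Rightarrow> nat \<Rightarrow> nat \<Rightarrow> int vec \<Rightarrow> real list" where
  "bob_angles n q Q a = concat (map (\<lambda>i. map (\<lambda>j. 2 ^ (j + 1) * pi * real_of_int (a $ i) / real q) [0..<Q]) [0..<n])"

lemma length_bob_angles [simp]: "length (bob_angles n q Q a) = n * Q"
  by (induction n) (auto simp: bob_angles_def)

text \<open>Puts Bob's doubly indexed list into the form of \<open>qubit_game\<close>, where the
  positions are consecutive and the first qubit can be split off repeatedly.\<close>

lemma bob_measurements: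
  "[(i * Q + j, xy_obs (2 ^ (j + 1) * pi * real_of_int (a $ i) / real q)). i \<leftarrow> [0..<n], j \<leftarrow> [0..<Q]] =
    zip [0..<n * Q] (map xy_obs (bob_angles n q Q a))"
proof (induction n)
  case (Suc n)
  have u: "[0..<Suc n * Q] = [0..<n * Q] @ map (\<lambda>j. n * Q + j) [0..<Q]"
  proof -
    have "[0..<Suc n * Q] = [0..<n * Q] @ [n * Q..<n * Q + Q]"
      by (metis add.commute mult_Suc upt_add_eq_append zero_le)
    then show ?thesis by (simp add: map_add_upt add.commute)
  qed
  have b: "bob_angles (Suc n) q Q a = bob_angles n q Q a @ map (\<lambda>j. 2 ^ (j + 1) * pi * real_of_int (a $ n) / real q) [0..<Q]"
    by (simp add: bob_angles_def)
  show ?case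
    unfolding u b map_append
    by (subst zip_append) (simp_all add: Suc.IH[symmetric] zip_map_map zip_same_conv_map)
qed (simp add: bob_angles_def)

lemma sum_list_angles_diff:
  assumes "length rs = length xs" "length xs = length ys"
  shows "(\<Sum>(r, x, y)\<leftarrow>zip rs (zip xs ys). r * (of_bool y - of_bool x)) =
    (\<Sum>(r, y)\<leftarrow>zip rs ys. r * of_bool y) - (\<Sum>(r, x)\<leftarrow>zip rs xs. r * of_bool x :: real)"
  using assms by (induction rs xs ys rule: list_induct3) (auto simp: algebra_simps)

text \<open>The factor \<open>2 ^ j\<close> in an angle is the weight of bit \<open>j\<close>, so
  the bits of each entry of \<open>x\<close> reassemble to that entry, and the total angle sees only
  the inner product of \<open>a\<close> and \<open>x\<close>.\<close>

lemma sum_list_bob_angles: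
  assumes x: "x \<in> Zvec q n" and q: "q \<le> 2 ^ Q"
  shows "(\<Sum>(r, b)\<leftarrow>zip (bob_angles n q Q a) (vec_bits Q x). r * of_bool b) =
    2 * pi / real q * real_of_int (\<Sum>i<n. a $ i * x $ i)"
proof -
  have dim: "dim_vec x = n" using x by (auto simp: Zvec_def)
  have l: "list_of_vec x = map (($) x) [0..<n]"
    using dim by (intro nth_equalityI) (auto simp: list_of_vec_index)
  have "int q \<le> 2 ^ Q" using q by (metis of_nat_le_iff of_nat_numeral of_nat_power)
  then have r: "0 \<le> x $ i" "x $ i < 2 ^ Q" if "i < n" for i
    using Zvec_index[OF x that] by linarith+
  have s: "(\<Sum>j\<leftarrow>[0..<Q]. 2 ^ (j + 1) * pi * real_of_int (a $ i) / real q * of_bool (bit (x $ i) j)) =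
      2 * pi / real q * real_of_int (a $ i * x $ i)" if "i < n" for i
  proof -
    have "(\<Sum>j\<leftarrow>[0..<Q]. 2 ^ (j + 1) * pi * real_of_int (a $ i) / real q * of_bool (bit (x $ i) j)) =
       (\<Sum>j<Q. 2 * pi / real q * real_of_int (a $ i) * real_of_int (of_bool (bit (x $ i) j) * 2 ^ j))"
      by (simp add: interv_sum_list_conv_sum_set_nat lessThan_atLeast0 mult_ac)
    also have "\<dots> = 2 * pi / real q * real_of_int (a $ i) * real_of_int (\<Sum>j<Q. of_bool (bit (x $ i) j) * 2 ^ j)"
      by (simp only: sum_distrib_left of_int_sum)
    finally show ?thesis unfolding sum_bit_eq[OF r[OF that]] by simp
  qed
  have "(\<Sum>(r, b)\<leftarrow>zip (bob_angles n q Q a) (vec_bits Q x). r * of_bool b) =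
      (\<Sum>i\<leftarrow>[0..<n]. \<Sum>j\<leftarrow>[0..<Q]. 2 ^ (j + 1) * pi * real_of_int (a $ i) / real q * of_bool (bit (x $ i) j))"
    unfolding bob_angles_def vec_bits_def l map_map
    by (subst zip_concat_map)
      (auto simp: bits_def zip_map_map zip_same_conv_map sum_list_concat_map o_def)
  also have "\<dots> = (\<Sum>i\<leftarrow>[0..<n]. 2 * pi / real q * real_of_int (a $ i * x $ i))"
    by (intro arg_cong[where f = sum_list] map_cong refl s) simp
  also have "\<dots> = (\<Sum>i<n. 2 * pi / real q * real_of_int (a $ i * x $ i))"
    by (simp only: interv_sum_list_conv_sum_set_nat lessThan_atLeast0 set_upt)
  finally show ?thesis by (simp add: sum_distrib_left)
qed

section \<open>The truncated discrete Gaussian\<close>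

definition gauss_weight :: "real \<Rightarrow> real \<Rightarrow> real" where
  "gauss_weight s x = exp (- x\<^sup>2 / (2 * s\<^sup>2))"

lemma gauss_weight_pos [simp]: "gauss_weight s x > 0" "gauss_weight s x \<ge> 0"
  by (simp_all add: gauss_weight_def)

lemma summable_gauss_weight_nat:
  assumes "s \<noteq> 0"
  shows "summable (\<lambda>n. gauss_weight s (real n))"
proof (rule summable_comparison_test'[where N = 0])
  show "summable (\<lambda>n. exp (- 1 / (2 * s\<^sup>2)) ^ n)"
    using assms by (intro summable_geometric) simp
  fix n :: nat
  have "real n \<le> (real n)\<^sup>2" by (cases n) (auto simp: power2_eq_square)
  then have "gauss_weight s (real n) \<le> exp (- real n / (2 * s\<^sup>2))"
    using assms by (simp add: gauss_weight_def divide_right_mono)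
  also have "\<dots> = exp (- 1 / (2 * s\<^sup>2)) ^ n"
    by (simp flip: exp_of_nat_mult)
  finally show "norm (gauss_weight s (real n)) \<le> exp (- 1 / (2 * s\<^sup>2)) ^ n" by simp
qed

lemma summable_on_gauss_weight_int:
  assumes "s \<noteq> 0"
  shows "(\<lambda>x::int. gauss_weight s (real_of_int x)) summable_on UNIV"
proof -
  have nat: "(\<lambda>n. gauss_weight s (real n)) summable_on UNIV"
    using summable_gauss_weight_nat[OF assms] by (intro norm_summable_imp_summable_on) simp
  have even: "gauss_weight s (- x) = gauss_weight s x" for x by (simp add: gauss_weight_def)
  have inj: "inj (\<lambda>n. - int n)" by (auto intro!: injI)
  have "(\<lambda>x::int. gauss_weight s (real_of_int x)) summable_on range int"
    using nat by (subst summable_on_reindex) (auto simp: o_def)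
  moreover have "(\<lambda>x::int. gauss_weight s (real_of_int x)) summable_on range (\<lambda>n. - int n)"
    using nat by (subst summable_on_reindex[OF inj]) (auto simp: o_def even)
  ultimately have "(\<lambda>x::int. gauss_weight s (real_of_int x)) summable_on (range int \<union> range (\<lambda>n. - int n))"
    by (rule summable_on_union)
  moreover have "range int \<union> range (\<lambda>n. - int n) = UNIV"
  proof -
    have "x \<in> range int \<union> range (\<lambda>n. - int n)" for x
      by (cases x rule: int_cases2) auto
    then show ?thesis by blast
  qed
  ultimately show ?thesis by simp
qed

text \<open>Summability of the weights gives total mass 1, as \<open>embed_pmf\<close> requires. The
  normalizing constant cancels after truncation, so only its positivity is recorded.\<close>

lemma pmf_gauss:
  assumes "s \<noteq> 0"
  obtains Z where "Z > 0" "\<And>x. pmf (gauss s) x = gauss_weight s (real_of_int x) / Z"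
proof
  define Z where "Z = (\<Sum>\<^sub>\<infinity>y::int. gauss_weight s (real_of_int y))"
  note sm = summable_on_gauss_weight_int[OF assms]
  have "(\<Sum>y\<in>{0::int}. gauss_weight s (real_of_int y)) \<le> Z"
    unfolding Z_def by (rule finite_sum_le_infsum[OF sm]) auto
  then show Z: "Z > 0" by (simp add: gauss_weight_def)
  define f where "f = (\<lambda>x::int. gauss_weight s (real_of_int x) / Z)"
  have f0: "f x \<ge> 0" for x using Z by (simp add: f_def)
  have fsm: "f summable_on UNIV"
    unfolding f_def divide_inverse by (intro summable_on_cmult_left sm)
  have "infsum f UNIV = 1"
    unfolding f_def divide_inverse using Z by (subst infsum_cmult_left) (auto simp: sm Z_def[symmetric])
  moreover have abs: "f abs_summable_on UNIV"
    using fsm summable_on_iff_abs_summable_on_real abs_summable_equivalent by blast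
  ultimately have "nn_integral (count_space UNIV) f = 1"
    using f0 by (simp add: nn_integral_conv_infsetsum infsetsum_infsum)
  moreover have "gauss s = embed_pmf f"
    by (simp add: gauss_def f_def Z_def gauss_weight_def)
  ultimately show "pmf (gauss s) x = gauss_weight s (real_of_int x) / Z" for x
    using Z by (subst \<open>gauss s = embed_pmf f\<close>, subst pmf_embed_pmf) (auto simp: f_def)
qed

lemma sum_int_symmetric:
  fixes f :: "int \<Rightarrow> real"
  assumes "\<And>x. f (- x) = f x"
  shows "(\<Sum>x\<in>{- int T..int T}. f x) = f 0 + 2 * (\<Sum>k=1..T. f (int k))"
proof (induction T)
  case (Suc T)
  have "{- int (Suc T)..int (Suc T)} = insert (int (Suc T)) (insert (- int (Suc T)) {- int T..int T})"
    by auto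
  moreover have "int (Suc T) \<notin> insert (- int (Suc T)) {- int T..int T}" "- int (Suc T) \<notin> {- int T..int T}"
    by auto
  ultimately have "(\<Sum>x\<in>{- int (Suc T)..int (Suc T)}. f x) =
      f (int (Suc T)) + (f (- int (Suc T)) + (\<Sum>x\<in>{- int T..int T}. f x))"
    by (metis finite_atLeastAtMost_int finite_insert sum.insert)
  with Suc assms[of "int (Suc T)"] show ?case by simp
qed auto

text \<open>Summation by parts, using \<open>\<gauss_weight>(k-1) - \<gauss_weight>(k) \<ge> \<gauss_weight>(k) (2k-1)/(2s\<^sup>2)\<close> and \<open>k\<^sup>2 \<ge> 2sk - s\<^sup>2\<close>.\<close>

lemma sum_mult_gauss_weight_le:
  assumes s: "s \<ge> 1"
  shows "(\<Sum>k=1..T. 3 / 2 * s * (real k * gauss_weight s (real k))) \<le>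
    s\<^sup>2 * (gauss_weight s 0 + 2 * (\<Sum>k=1..T. gauss_weight s (real k)) - (real T + 1) * gauss_weight s (real T))"
proof (induction T)
  case 0
  then show ?case by simp
next
  case (Suc T)
  define k where "k = real T + 1"
  have k: "k \<ge> 1" by (simp add: k_def)
  have r: "gauss_weight s (real T) \<ge> gauss_weight s k * (1 + (2 * k - 1) / (2 * s\<^sup>2))"
  proof -
    have "- (real T)\<^sup>2 = - k\<^sup>2 + (2 * k - 1)"
      by (simp add: k_def power2_eq_square algebra_simps)
    then have "gauss_weight s (real T) = gauss_weight s k * exp ((2 * k - 1) / (2 * s\<^sup>2))"
      by (simp only: gauss_weight_def add_divide_distrib exp_add)
    then show ?thesis by (simp add: exp_ge_add_one_self)
  qed
  have "3 / 2 * s * k \<le> k\<^sup>2 - k / 2 + s\<^sup>2"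
  proof -
    \<comment> \<open>The second summand uses \<open>s \<ge> 1\<close>: it pays for the lost
      \<open>k / 2\<close> and lowers the coefficient of \<open>s * k\<close> from 2 to 3/2.\<close>
    have "0 \<le> (k - s)\<^sup>2 + (s - 1) * k / 2" using s k by simp
    then show ?thesis by (simp add: power2_eq_square field_simps)
  qed
  then have "3 / 2 * s * k * gauss_weight s k \<le> (k\<^sup>2 - k / 2 + s\<^sup>2) * gauss_weight s k"
    by (intro mult_right_mono) auto
  also have "\<dots> = s\<^sup>2 * k * (gauss_weight s k * (1 + (2 * k - 1) / (2 * s\<^sup>2)) - gauss_weight s k) + s\<^sup>2 * gauss_weight s k"
    using s by (simp add: field_simps power2_eq_square)
  also have "\<dots> \<le> s\<^sup>2 * k * (gauss_weight s (real T) - gauss_weight s k) + s\<^sup>2 * gauss_weight s k"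
    using r s k by (intro add_right_mono mult_left_mono) auto
  \<comment> \<open>The right-hand side is exactly the increment of the claimed bound from
    \<open>T\<close> to \<open>Suc T\<close>.\<close>
  finally have "3 / 2 * s * (k * gauss_weight s k) \<le> s\<^sup>2 * (k * (gauss_weight s (real T) - gauss_weight s k) + gauss_weight s k)"
    by (simp add: algebra_simps)
  then show ?case using Suc by (simp add: k_def algebra_simps add_divide_distrib)
qed

text \<open>By symmetry the numerator of the expectation is twice a sum over positive
  \<open>k\<close>. Dropping the boundary term of \<open>sum_mult_gauss_weight_le\<close> bounds
  that sum by \<open>s\<^sup>2 * S / (3 / 2 * s)\<close>, and doubling gives the constant
  4/3.\<close>

lemma tgauss_bounds:
  assumes s: "s \<ge> 1" and t: "t \<ge> 0"
  shows "x \<in> set_pmf (tgauss s t) \<Longrightarrow> \<bar>real_of_int x\<bar> \<le> t"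
    and "finite (set_pmf (tgauss s t))"
    and "measure_pmf.expectation (tgauss s t) (\<lambda>x. real_of_int \<bar>x\<bar>) \<le> 4 / 3 * s"
proof -
  obtain Z where Z: "Z > 0" "\<And>x. pmf (gauss s) x = gauss_weight s (real_of_int x) / Z"
    using pmf_gauss[of s] s by auto
  define T where "T = nat \<lfloor>t\<rfloor>"
  define I where "I = {- int T..int T}"
  have I: "{x. \<bar>real_of_int x\<bar> \<le> t} = I"
    unfolding I_def T_def using t by (auto simp: le_floor_iff) linarith+
  have ne: "set_pmf (gauss s) \<inter> I \<noteq> {}"
  proof -
    have "0 \<in> set_pmf (gauss s)" using Z by (auto simp: set_pmf_iff gauss_weight_def)
    then show ?thesis by (auto simp: I_def)
  qed
  have set: "set_pmf (tgauss s t) = set_pmf (gauss s) \<inter> I"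
    unfolding tgauss_def I using ne by (simp add: set_cond_pmf)
  then show "x \<in> set_pmf (tgauss s t) \<Longrightarrow> \<bar>real_of_int x\<bar> \<le> t" using I by auto
  show "finite (set_pmf (tgauss s t))" unfolding set I_def by simp
  define S where "S = (\<Sum>x\<in>I. gauss_weight s (real_of_int x))"
  have S: "S > 0" unfolding S_def I_def by (intro sum_pos) auto
  have "measure (gauss s) I = S / Z"
    unfolding S_def using Z by (subst measure_measure_pmf_finite) (auto simp: I_def sum_divide_distrib)
  then have p: "pmf (tgauss s t) x = gauss_weight s (real_of_int x) / S" if "x \<in> I" for x
    unfolding tgauss_def I using that Z by (simp add: pmf_cond[OF ne])
  have "measure_pmf.expectation (tgauss s t) (\<lambda>x. real_of_int \<bar>x\<bar>) =
      (\<Sum>x\<in>I. pmf (tgauss s t) x * real_of_int \<bar>x\<bar>)"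
    using set by (subst integral_measure_pmf[of I]) (auto simp: I_def)
  also have "\<dots> = (\<Sum>x\<in>I. real_of_int \<bar>x\<bar> * gauss_weight s (real_of_int x)) / S"
    unfolding sum_divide_distrib by (intro sum.cong) (auto simp: p)
  also have "\<dots> \<le> 4 / 3 * s"
  proof -
    have S2: "S = gauss_weight s 0 + 2 * (\<Sum>k=1..T. gauss_weight s (real k))"
      unfolding S_def I_def by (subst sum_int_symmetric) (auto simp: gauss_weight_def)
    have "(\<Sum>x\<in>I. real_of_int \<bar>x\<bar> * gauss_weight s (real_of_int x)) = 2 * (\<Sum>k=1..T. real k * gauss_weight s (real k))"
      unfolding I_def by (subst sum_int_symmetric) (auto simp: gauss_weight_def)
    moreover have "3 / 2 * s * (\<Sum>k=1..T. real k * gauss_weight s (real k)) \<le> s\<^sup>2 * S"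
    proof -
      have "3 / 2 * s * (\<Sum>k=1..T. real k * gauss_weight s (real k)) \<le> s\<^sup>2 * (S - (real T + 1) * gauss_weight s (real T))"
        using sum_mult_gauss_weight_le[OF s, of T] by (simp add: S2 sum_distrib_left)
      also have "\<dots> \<le> s\<^sup>2 * S" by (intro mult_left_mono) auto
      finally show ?thesis .
    qed
    ultimately have "3 / 4 * s * (\<Sum>x\<in>I. real_of_int \<bar>x\<bar> * gauss_weight s (real_of_int x)) \<le> s * (s * S)"
      by (simp add: power2_eq_square mult.assoc)
    then have "3 / 4 * (\<Sum>x\<in>I. real_of_int \<bar>x\<bar> * gauss_weight s (real_of_int x)) \<le> s * S"
      using s by (simp add: mult.assoc mult.left_commute)
    then show ?thesis using S by (simp add: pos_divide_le_eq)
  qed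
  finally show "measure_pmf.expectation (tgauss s t) (\<lambda>x. real_of_int \<bar>x\<bar>) \<le> 4 / 3 * s" .
qed

lemma expectation_replicate_pmf_sum_list:
  fixes h :: "'a \<Rightarrow> real"
  assumes "finite (set_pmf p)"
  shows "measure_pmf.expectation (replicate_pmf n p) (\<lambda>xs. \<Sum>x\<leftarrow>xs. h x) =
    real n * measure_pmf.expectation p h"
proof (induction n)
  case (Suc n)
  have fin: "finite (set_pmf (replicate_pmf n p))"
    using assms finite_lists_length_eq[of "set_pmf p" n] by (simp add: set_replicate_pmf lists_eq_set)
  have int: "integrable (measure_pmf (replicate_pmf n p)) g" for g :: "_ \<Rightarrow> real"
    using fin by (rule integrable_measure_pmf_finite)
  have r: "replicate_pmf (Suc n) p = p \<bind> (\<lambda>x. map_pmf ((#) x) (replicate_pmf n p))"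
    by (simp add: map_pmf_def)
  have "measure_pmf.expectation (replicate_pmf (Suc n) p) (\<lambda>xs. \<Sum>x\<leftarrow>xs. h x) =
     (\<Sum>x\<in>set_pmf p. pmf p x * (h x + real n * measure_pmf.expectation p h))"
    unfolding r using assms fin
    by (subst pmf_expectation_bind[OF assms]) (auto simp: Suc.IH Bochner_Integration.integral_add[OF int int])
  also have "\<dots> = (\<Sum>x\<in>set_pmf p. pmf p x * h x) + (\<Sum>x\<in>set_pmf p. pmf p x) * (real n * measure_pmf.expectation p h)"
    by (simp add: distrib_left sum.distrib flip: sum_distrib_right)
  also have "(\<Sum>x\<in>set_pmf p. pmf p x) = 1"
    using assms by (intro sum_pmf_eq_1) auto
  also have "(\<Sum>x\<in>set_pmf p. pmf p x * h x) = measure_pmf.expectation p h"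
    using assms by (subst integral_measure_pmf[of "set_pmf p"]) auto
  finally show ?case by (simp add: algebra_simps)
qed simp

section \<open>Integer vectors modulo \<open>q\<close>\<close>

lemma redv_index [simp]: "i < dim_vec x \<Longrightarrow> redv q x $ i = x $ i mod int q"
  by (simp add: redv_def)

lemma dim_redv [simp]: "dim_vec (redv q x) = dim_vec x"
  by (simp add: redv_def)

lemma redv_in_Zvec:
  assumes "q > 0" "dim_vec x = n"
  shows "redv q x \<in> Zvec q n"
  using assms by (auto simp: Zvec_def intro!: carrier_vecI)

lemma dim_Zvec: "x \<in> Zvec q n \<Longrightarrow> dim_vec x = n"
  by (auto simp: Zvec_def)

lemma cong_scalar_prod_redv:
  assumes "dim_vec x = dim_vec r"
  shows "[r \<bullet> redv q x = r \<bullet> x] (mod int q)"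
  unfolding scalar_prod_def using assms
  by (auto intro!: cong_sum cong_mult)

section \<open>Collisions: shifting a preimage by the secret\<close>

context
  fixes q m n :: nat and A :: "int mat" and s e v :: "int vec"
  assumes A: "A \<in> carrier_mat m n" and s: "dim_vec s = n" and e: "dim_vec e = m" and v: "dim_vec v = m"
    and ve: "redv q v = redv q (A *\<^sub>v s + e)"
begin

lemma cong_v: "i < m \<Longrightarrow> [v $ i = row A i \<bullet> s + e $ i] (mod int q)"
  using arg_cong[OF ve, of "\<lambda>v. v $ i"] A e v by (simp add: cong_def)

lemma cong_row_add:
  assumes "dim_vec x = n" "i < m"
  shows "[row A i \<bullet> redv q (x + s) = row A i \<bullet> x + row A i \<bullet> s] (mod int q)"
proof -
  have "row A i \<bullet> (x + s) = row A i \<bullet> x + row A i \<bullet> s"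
    by (rule scalar_prod_add_distrib[of _ n]) (use A s assms in \<open>auto intro: carrier_vecI\<close>)
  then show ?thesis
    using cong_scalar_prod_redv[of "x + s" "row A i" q] A s assms by simp
qed

lemma cong_row_diff:
  assumes "dim_vec x = n" "i < m"
  shows "[row A i \<bullet> redv q (x - s) = row A i \<bullet> x - row A i \<bullet> s] (mod int q)"
proof -
  have "row A i \<bullet> (x - s) = row A i \<bullet> x - row A i \<bullet> s"
    by (rule scalar_prod_minus_distrib[of _ n]) (use A s assms in \<open>auto intro: carrier_vecI\<close>)
  then show ?thesis
    using cong_scalar_prod_redv[of "x - s" "row A i" q] A s assms by simp
qed

lemma cong_redv_index: "i < dim_vec x \<Longrightarrow> [redv q x $ i = x $ i] (mod int q)"
  by (simp add: cong_def)

text \<open>The triples \<open>(x, 0, g)\<close> and \<open>(x + s, 1, g + e)\<close> collide,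
  because \<open>v\<close> is \<open>A s + e\<close> modulo \<open>q\<close>. This is what entangles
  \<open>c\<close> with the secret.\<close>

lemma redv_shift_add:
  assumes x: "dim_vec x = n" and g: "dim_vec g = m"
  shows "redv q (A *\<^sub>v redv q (x + s) - of_bool True \<cdot>\<^sub>v v + redv q (g + e)) =
    redv q (A *\<^sub>v x - of_bool False \<cdot>\<^sub>v v + g)"
proof (rule eq_vecI)
  fix i assume "i < dim_vec (redv q (A *\<^sub>v x - of_bool False \<cdot>\<^sub>v v + g))"
  then have i: "i < m" using g by simp
  have "[row A i \<bullet> redv q (x + s) - v $ i + redv q (g + e) $ i =
      row A i \<bullet> x + row A i \<bullet> s - (row A i \<bullet> s + e $ i) + (g + e) $ i] (mod int q)"
    by (intro cong_add cong_diff cong_row_add cong_v cong_redv_index) (use x g e i in auto)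
  then show "redv q (A *\<^sub>v redv q (x + s) - of_bool True \<cdot>\<^sub>v v + redv q (g + e)) $ i =
    redv q (A *\<^sub>v x - of_bool False \<cdot>\<^sub>v v + g) $ i"
    using i A e v g s x by (simp add: cong_def algebra_simps)
qed (use e g in simp)

lemma redv_shift_diff:
  assumes x: "dim_vec x = n" and g: "dim_vec g = m"
  shows "redv q (A *\<^sub>v redv q (x - s) - of_bool False \<cdot>\<^sub>v v + redv q (g - e)) =
    redv q (A *\<^sub>v x - of_bool True \<cdot>\<^sub>v v + g)"
proof (rule eq_vecI)
  fix i assume "i < dim_vec (redv q (A *\<^sub>v x - of_bool True \<cdot>\<^sub>v v + g))"
  then have i: "i < m" using g by simp
  have "[row A i \<bullet> redv q (x - s) + redv q (g - e) $ i + v $ i =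
      row A i \<bullet> x - row A i \<bullet> s + (g - e) $ i + (row A i \<bullet> s + e $ i)] (mod int q)"
    by (intro cong_add cong_diff cong_row_diff cong_v cong_redv_index) (use x g e i in auto)
  then have "[row A i \<bullet> redv q (x - s) + redv q (g - e) $ i + v $ i - v $ i =
      row A i \<bullet> x + g $ i - v $ i] (mod int q)"
    using i e by (intro cong_diff) simp_all
  then show "redv q (A *\<^sub>v redv q (x - s) - of_bool False \<cdot>\<^sub>v v + redv q (g - e)) $ i =
    redv q (A *\<^sub>v x - of_bool True \<cdot>\<^sub>v v + g) $ i"
    using i A e v g s x by (simp add: cong_def algebra_simps)
qed (use e g in simp)

lemma redv_false:
  assumes g: "dim_vec g = m"
  shows "redv q (A *\<^sub>v x - of_bool False \<cdot>\<^sub>v v + g) = redv q (A *\<^sub>v x + g)"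
  by (rule eq_vecI) (use g A v in auto)

lemma redv_add_v_true:
  assumes g: "dim_vec g = m"
  shows "redv q (redv q (A *\<^sub>v x - of_bool True \<cdot>\<^sub>v v + g) + v) = redv q (A *\<^sub>v x + g)"
  by (rule eq_vecI) (use g A v in \<open>auto simp: mod_simps\<close>)

text \<open>For \<open>c = 0\<close>, adding \<open>v\<close> to the response gives a noisy image of
  \<open>x + s\<close> with error \<open>g + e\<close>; this is what Alice's second inversion
  sees.\<close>

lemma redv_add_v_false:
  assumes x: "dim_vec x = n" and g: "dim_vec g = m"
  shows "redv q (redv q (A *\<^sub>v x - of_bool False \<cdot>\<^sub>v v + g) + v) =
    redv q (A *\<^sub>v redv q (x + s) + redv q (g + e))"
  unfolding redv_shift_add[OF x g, symmetric] by (rule redv_add_v_true) (use g e in simp)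

lemma redv_inj:
  assumes g: "g \<in> Zvec q m" "g' \<in> Zvec q m"
    and eq: "redv q (A *\<^sub>v x - of_bool c \<cdot>\<^sub>v v + g) = redv q (A *\<^sub>v x - of_bool c \<cdot>\<^sub>v v + g')"
  shows "g = g'"
proof (rule eq_vecI)
  fix i assume "i < dim_vec g'"
  then have i: "i < m" using dim_Zvec[OF g(2)] by simp
  define z where "z = (A *\<^sub>v x - of_bool c \<cdot>\<^sub>v v) $ i"
  have "[z + g $ i = z + g' $ i] (mod int q)"
    using arg_cong[OF eq, of "\<lambda>v. v $ i"] i dim_Zvec[OF g(1)] dim_Zvec[OF g(2)]
    by (simp add: z_def cong_def)
  then have "[g $ i = g' $ i] (mod int q)" by (simp add: cong_add_lcancel)
  then show "g $ i = g' $ i"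
    using Zvec_index[OF g(1) i] Zvec_index[OF g(2) i] by (simp add: cong_def)
qed (use g dim_Zvec in metis)

end

section \<open>The norm modulo \<open>q\<close> and centered representatives\<close>

lemma zq_abs_mod_le:
  assumes "q > 0"
  shows "zq_abs q (z mod int q) \<le> \<bar>z\<bar>"
proof (cases "z \<ge> 0")
  case True
  then show ?thesis using zmod_le_nonneg_dividend[of z "int q"] by (simp add: zq_abs_def)
next
  case False
  have "int q - z mod int q \<le> - z \<or> z mod int q = 0"
    using False zmod_le_nonneg_dividend[of "- z" "int q"] by (auto simp: zmod_zminus1_eq_if split: if_splits)
  then show ?thesis using False by (auto simp: zq_abs_def)
qed

text \<open>Positive dimension keeps \<open>Max\<close> away from the empty set, where it is
  unspecified.\<close>

lemma zq_norm_le_iff: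
  assumes "dim_vec v > 0"
  shows "real_of_int (zq_norm q v) \<le> t \<longleftrightarrow> (\<forall>i<dim_vec v. real_of_int (zq_abs q (v $ i)) \<le> t)"
proof -
  have "real_of_int (zq_norm q v) \<le> t \<longleftrightarrow> zq_norm q v \<le> \<lfloor>t\<rfloor>" by (simp add: le_floor_iff)
  also have "\<dots> \<longleftrightarrow> (\<forall>i<dim_vec v. zq_abs q (v $ i) \<le> \<lfloor>t\<rfloor>)"
    unfolding zq_norm_def using assms by (subst Max_le_iff) auto
  finally show ?thesis by (simp add: le_floor_iff)
qed

lemma finite_Zvec: "finite (Zvec q n)"
proof (rule finite_subset)
  show "Zvec q n \<subseteq> (\<lambda>h. vec n h) ` ({..<n} \<rightarrow>\<^sub>E {0..<int q})"
  proof
    fix x assume x: "x \<in> Zvec q n"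
    then have "x = vec n (restrict (($) x) {..<n})"
      by (intro eq_vecI) (auto simp: Zvec_def)
    then show "x \<in> (\<lambda>h. vec n h) ` ({..<n} \<rightarrow>\<^sub>E {0..<int q})"
      using x by (intro image_eqI[of _ _ "restrict (($) x) {..<n}"]) (auto simp: Zvec_def)
  qed
qed (auto intro: finite_PiE)

lemma Zvec_nonempty: "q > 0 \<Longrightarrow> Zvec q n \<noteq> {}"
  using redv_in_Zvec[of q "0\<^sub>v n" n] by auto

text \<open>The centered integer lifts of the error vectors. On lifts, adding \<open>e\<close> is
  plain integer addition, and as a product of intervals the set is easily counted.\<close>

definition int_box :: "nat \<Rightarrow> int \<Rightarrow> (nat \<Rightarrow> int) set" where
  "int_box m T = {..<m} \<rightarrow>\<^sub>E {-T..T}"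

lemma int_box_index: "h \<in> int_box m T \<Longrightarrow> i < m \<Longrightarrow> \<bar>h i\<bar> \<le> T"
  unfolding int_box_def by (drule PiE_mem[of _ _ _ i]) auto

lemma bij_betw_int_box:
  assumes m: "m > 0" and T: "T = \<lfloor>\<tau>\<rfloor>" "2 * T < int q" "0 \<le> T"
  shows "bij_betw (\<lambda>h. redv q (vec m h)) (int_box m T) {g \<in> Zvec q m. real_of_int (zq_norm q g) \<le> \<tau>}"
proof (rule bij_betw_imageI)
  have q: "q > 0" using T(2,3) by linarith
  have centered: "h i = h' i" if "h \<in> int_box m T" "h' \<in> int_box m T" "i < m" "h i mod q = h' i mod q" for h h' i
  proof -
    have r: "\<bar>h i\<bar> \<le> T" "\<bar>h' i\<bar> \<le> T" using that(1-3) int_box_index by auto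
    \<comment> \<open>Adding \<open>T\<close> moves the interval to \<open>0..2T\<close>, where
      reduction modulo \<open>q\<close> is the identity because \<open>2 * T < q\<close>.\<close>
    then have "(h i + T) mod q = h i + T" "(h' i + T) mod q = h' i + T"
      using r T(2) by simp_all
    then show ?thesis using that(4) by (metis add_right_cancel mod_add_cong)
  qed
  show "inj_on (\<lambda>h. redv q (vec m h)) (int_box m T)"
  proof (rule inj_onI)
    fix h h' assume h: "h \<in> int_box m T" "h' \<in> int_box m T" and eq: "redv q (vec m h) = redv q (vec m h')"
    have "h i = h' i" if "i < m" for i
      using arg_cong[OF eq, of "\<lambda>v. v $ i"] that centered[OF h that] by simp
    then show "h = h'" using PiE_ext[OF h[unfolded int_box_def]] by simp
  qed
  show "(\<lambda>h. redv q (vec m h)) ` int_box m T = {g \<in> Zvec q m. real_of_int (zq_norm q g) \<le> \<tau>}"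
  proof (intro equalityI subsetI)
    fix g assume "g \<in> (\<lambda>h. redv q (vec m h)) ` int_box m T"
    then obtain h where h: "h \<in> int_box m T" "g = redv q (vec m h)" by auto
    have "zq_abs q (g $ i) \<le> T" if "i < m" for i
      using zq_abs_mod_le[OF q, of "h i"] that h(2) int_box_index[OF h(1) that] by simp
    moreover have "g \<in> Zvec q m" "dim_vec g = m" using h q by (simp_all add: redv_in_Zvec)
    ultimately show "g \<in> {g \<in> Zvec q m. real_of_int (zq_norm q g) \<le> \<tau>}"
      using m T by (simp add: zq_norm_le_iff le_floor_iff)
  next
    fix g assume g: "g \<in> {g \<in> Zvec q m. real_of_int (zq_norm q g) \<le> \<tau>}"
    have dim: "dim_vec g = m" using g dim_Zvec by auto
    \<comment> \<open>The inverse map: residues above \<open>T\<close> stand for negative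
      integers.\<close>
    define h where "h = restrict (\<lambda>i. if g $ i \<le> T then g $ i else g $ i - int q) {..<m}"
    have "zq_abs q (g $ i) \<le> T" if "i < m" for i
      using that g m dim T by (auto simp: zq_norm_le_iff le_floor_iff)
    moreover have "0 \<le> g $ i" "g $ i < int q" if "i < m" for i using that g Zvec_index by auto
    ultimately have "(if g $ i \<le> T then g $ i else g $ i - int q) \<in> {-T..T}" if "i < m" for i
      using that T(3) by (force simp: zq_abs_def min_def split: if_splits)
    then have "h \<in> int_box m T"
      unfolding h_def int_box_def restrict_PiE_iff by auto
    moreover have "g = redv q (vec m h)"
      using g dim Zvec_index[of g q m] by (intro eq_vecI) (auto simp: h_def)
    ultimately show "g \<in> (\<lambda>h. redv q (vec m h)) ` int_box m T" by auto
  qed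
qed

text \<open>Only coordinate \<open>i\<close> is constrained, and a shift by \<open>z\<close> pushes
  at most \<open>\<bar>z\<bar>\<close> of its \<open>2 * T + 1\<close> values out of the interval,
  all at the end towards which \<open>z\<close> points.\<close>

lemma card_int_box_shift_le:
  assumes T: "T \<ge> 0" and i: "i < m"
  shows "real (card {h \<in> int_box m T. \<bar>h i + z\<bar> > T}) \<le> real (card (int_box m T)) * \<bar>real_of_int z\<bar> / (2 * real_of_int T + 1)"
proof -
  define B where "B = {k \<in> {-T..T}. \<bar>k + z\<bar> > T}"
  have "{h \<in> int_box m T. \<bar>h i + z\<bar> > T} = PiE {..<m} (\<lambda>j. if j = i then B else {-T..T})"
    using i by (auto simp: B_def int_box_def PiE_def Pi_def split: if_splits)
  then have c1: "card {h \<in> int_box m T. \<bar>h i + z\<bar> > T} = (\<Prod>j<m. card (if j = i then B else {-T..T}))"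
    by (simp add: card_PiE)
  also have "\<dots> = card B * (\<Prod>j\<in>{..<m} - {i}. card {-T..T})"
    using i by (subst prod.remove[of _ i]) auto
  finally have c: "card {h \<in> int_box m T. \<bar>h i + z\<bar> > T} = card B * card {-T..T} ^ (m - 1)"
    using i by simp
  have d: "card (int_box m T) = card {-T..T} * card {-T..T} ^ (m - 1)"
    using i by (simp add: int_box_def card_PiE flip: power_Suc)
  have "B \<subseteq> (if z \<ge> 0 then {T - z + 1..T} else {-T..-T - z - 1})" by (auto simp: B_def)
  then have "card B \<le> card (if z \<ge> 0 then {T - z + 1..T} else {-T..-T - z - 1})"
    by (intro card_mono) auto
  then have B: "real (card B) \<le> \<bar>real_of_int z\<bar>" by (auto split: if_splits)
  define N where "N = card {-T..T}"
  have N: "real N = 2 * real_of_int T + 1" "real N > 0" using T by (simp_all add: N_def)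
  have "real (card B) * real N ^ (m - 1) \<le> \<bar>real_of_int z\<bar> * real N ^ (m - 1)"
    using B by (intro mult_right_mono) auto
  then show ?thesis unfolding c d N(1)[symmetric] N_def[symmetric] using N(2) by (simp add: mult_ac)
qed

section \<open>The honest response\<close>

lemma pmf_bind_ge:
  assumes "\<And>x. x \<in> set_pmf p \<Longrightarrow> c \<le> pmf (f x) i"
  shows "c \<le> pmf (bind_pmf p f) i"
  unfolding pmf_bind
  by (rule measure_pmf.integral_ge_const)
    (use assms in \<open>auto intro!: measure_pmf.integrable_const_bound[where B = 1] simp: AE_measure_pmf_iff pmf_le_1\<close>)

lemma pmf_bind_ge_expectation:
  assumes "finite (set_pmf p)" "\<And>x. x \<in> set_pmf p \<Longrightarrow> g x \<le> pmf (f x) i"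
  shows "measure_pmf.expectation p g \<le> pmf (bind_pmf p f) i"
  unfolding pmf_bind using assms
  by (intro integral_mono_AE integrable_measure_pmf_finite) (auto simp: AE_measure_pmf_iff)

text \<open>The probability is an average over \<open>\<Omega>\<close>; falling into
  \<open>Bad\<close> costs at most \<open>\<kappa>\<close>.\<close>

lemma pmf_bind_pmf_of_set_ge:
  assumes "finite \<Omega>" "\<Omega> \<noteq> {}" "Bad \<subseteq> \<Omega>"
    and "\<And>x. x \<in> \<Omega> \<Longrightarrow> x \<notin> Bad \<Longrightarrow> c \<le> pmf (f x) i" "\<And>x. x \<in> Bad \<Longrightarrow> c - \<kappa> \<le> pmf (f x) i"
  shows "c - \<kappa> * (real (card Bad) / real (card \<Omega>)) \<le> pmf (bind_pmf (pmf_of_set \<Omega>) f) i"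
proof -
  have "real (card \<Omega>) * c - \<kappa> * real (card Bad) = (\<Sum>x\<in>\<Omega>. c - \<kappa> * of_bool (x \<in> Bad))"
    using assms(1,3) by (simp add: sum_subtractf Int_absorb1 flip: sum_distrib_left)
  also have "\<dots> \<le> (\<Sum>x\<in>\<Omega>. pmf (f x) i)"
    using assms(4,5) by (intro sum_mono) (auto simp: of_bool_def)
  finally have "real (card \<Omega>) * c - \<kappa> * real (card Bad) \<le> (\<Sum>x\<in>\<Omega>. pmf (f x) i)" .
  moreover have "card \<Omega> > 0" using assms(1,2) by (simp add: card_gt_0_iff)
  ultimately have "(real (card \<Omega>) * c - \<kappa> * real (card Bad)) / real (card \<Omega>) \<le> (\<Sum>x\<in>\<Omega>. pmf (f x) i) / real (card \<Omega>)"
    by (intro divide_right_mono) auto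
  then show ?thesis
    using assms(1,2) \<open>card \<Omega> > 0\<close> by (simp add: pmf_bind_pmf_of_set diff_divide_distrib)
qed

section \<open>Trigonometric estimates and phases modulo \<open>q\<close>\<close>

lemma cos_diff_le: "\<bar>cos x - cos y\<bar> \<le> \<bar>x - y\<bar>" for x y :: real
proof -
  have "\<bar>cos x - cos y\<bar> = 2 * (\<bar>sin ((x + y) / 2)\<bar> * \<bar>sin ((y - x) / 2)\<bar>)"
    by (simp add: cos_diff_cos abs_mult)
  also have "\<dots> \<le> 2 * (1 * \<bar>(y - x) / 2\<bar>)"
    by (intro mult_left_mono mult_mono abs_sin_le_one abs_sin_x_le_abs_x) auto
  finally show ?thesis by simp
qed

text \<open>For \<open>\<delta> = 0\<close> the angle is \<open>pi / 4\<close> up to sign, except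
  for \<open>b = b' = 1\<close>, where it is \<open>3 * pi / 4\<close> and the outer sign repairs
  the cosine. The deviation \<open>\<delta>\<close> is absorbed by the Lipschitz bound
  \<open>cos_diff_le\<close>.\<close>

lemma chsh_angle:
  fixes b b' :: bool
  shows "sqrt 2 / 2 - \<bar>\<delta>\<bar> \<le> (-1) ^ of_bool (b \<and> b') * cos (of_bool b * (pi / 2) + \<delta> - (-1) ^ of_bool b' * pi / 4)"
proof -
  have "\<bar>cos (\<delta> + pi / 4) - cos (pi / 4)\<bar> \<le> \<bar>\<delta>\<bar>" "\<bar>cos (\<delta> - pi / 4) - cos (- (pi / 4))\<bar> \<le> \<bar>\<delta>\<bar>"
    using cos_diff_le[of "\<delta> + pi / 4" "pi / 4"] cos_diff_le[of "\<delta> - pi / 4" "- (pi / 4)"] by auto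
  then have c: "sqrt 2 / 2 - \<bar>\<delta>\<bar> \<le> cos (\<delta> + pi / 4)" "sqrt 2 / 2 - \<bar>\<delta>\<bar> \<le> cos (\<delta> - pi / 4)"
    by (auto simp: cos_45 abs_le_iff)
  have e: "pi / 2 + \<delta> - pi / 4 = \<delta> + pi / 4" "pi / 2 + \<delta> - - 1 * pi / 4 = (\<delta> - pi / 4) + pi"
    by (simp_all add: field_simps)
  show ?thesis
  proof (cases b; cases b')
    assume "b" "b'"
    then show ?thesis using c(2) e(2) cos_periodic_pi[of "\<delta> - pi / 4"] by simp
  qed (use c e in \<open>auto simp: add.commute\<close>)
qed

lemma cis_cong:
  assumes "[k = k'] (mod int q)" "q > 0"
  shows "cis (2 * pi / real q * real_of_int k - \<xi>) = cis (2 * pi / real q * real_of_int k' - \<xi>)"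
proof -
  obtain j where "k = k' + int q * j"
    using assms(1) by (metis cong_iff_lin cong_sym)
  then have "2 * pi / real q * real_of_int k - \<xi> = (2 * pi / real q * real_of_int k' - \<xi>) + 2 * pi * real_of_int j"
    using assms(2) by (simp add: field_simps)
  then show ?thesis by (simp only: cis_mult[symmetric] cis_multiple_2pi[OF Ints_of_int]) simp
qed

lemma zq_norm_redv_le:
  assumes "q > 0" "dim_vec z > 0" "\<And>i. i < dim_vec z \<Longrightarrow> \<bar>real_of_int (z $ i)\<bar> \<le> t"
  shows "real_of_int (zq_norm q (redv q z)) \<le> t"
proof -
  have "real_of_int (zq_abs q (z $ i mod int q)) \<le> t" if "i < dim_vec z" for i
  proof -
    have "real_of_int (zq_abs q (z $ i mod int q)) \<le> real_of_int \<bar>z $ i\<bar>"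
      using zq_abs_mod_le[OF assms(1)] of_int_le_iff by blast
    then show ?thesis using assms(3)[OF that] by simp
  qed
  then show ?thesis using assms(2) by (subst zq_norm_le_iff) auto
qed

section \<open>Bob's run for a fixed key, with \<open>e\<close> the integer error before
  reduction\<close>

context
  fixes q Q m n :: nat and \<tau> :: real and A :: "int mat" and s e v :: "int vec" and Inv :: "int vec \<Rightarrow> int vec"
  assumes q: "q > 0" and qQ: "q \<le> 2 ^ Q" and m: "m > 0" and tau: "0 \<le> \<tau>" "4 * \<tau> \<le> real q"
    and A: "A \<in> carrier_mat m n" and s: "s \<in> Zvec q n"
    and e: "dim_vec e = m" "\<And>i. i < m \<Longrightarrow> \<bar>real_of_int (e $ i)\<bar> \<le> \<tau>"
    and v: "v = redv q (A *\<^sub>v s + e)"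
    and inv_range: "\<And>y. y \<in> Zvec q m \<Longrightarrow> Inv y \<in> Zvec q n"
    and inv_correct: "\<And>x g. x \<in> Zvec q n \<Longrightarrow> g \<in> Zvec q m \<Longrightarrow> real_of_int (zq_norm q g) \<le> 2 * \<tau> \<Longrightarrow>
      Inv (redv q (A *\<^sub>v x + g)) = x"
begin

lemma honest_dims: "dim_vec s = n" "dim_vec v = m" "redv q v = redv q (A *\<^sub>v s + e)"
  using s e A by (auto simp: v dim_Zvec)

lemmas honest_shift = redv_shift_add[OF A honest_dims(1) e(1) honest_dims(2,3)] redv_shift_diff[OF A honest_dims(1) e(1) honest_dims(2,3)]
  redv_false[OF A honest_dims(1) e(1) honest_dims(2,3)] redv_add_v_true[OF A honest_dims(1) e(1) honest_dims(2,3)]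
  redv_add_v_false[OF A honest_dims(1) e(1) honest_dims(2,3)]

definition response :: "int vec \<times> bool \<times> int vec \<Rightarrow> int vec" where
  "response = (\<lambda>(x, c, g). redv q (A *\<^sub>v x - of_bool c \<cdot>\<^sub>v v + g))"

definition honest_support :: "(bool list \<times> int vec) set" where
  "honest_support = (\<lambda>(x, c, g). (vec_bits Q x @ [c], response (x, c, g))) ` honest_triples n m q \<tau>"

text \<open>Alice's two inversions of \<open>y\<close>. By \<open>honest_support_cases\<close> they
  are the only possible contents of Bob's first register, so Alice computes \<open>d\<close> from
  the very strings that label the branches.\<close>

definition branch0 :: "int vec \<Rightarrow> bool list" where "branch0 y = vec_bits Q (Inv y)"
definition branch1 :: "int vec \<Rightarrow> bool list" where "branch1 y = vec_bits Q (Inv (redv q (y + v)))"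

lemma honest_triples_iff:
  "(x, c, g) \<in> honest_triples n m q \<tau> \<longleftrightarrow> x \<in> Zvec q n \<and> g \<in> Zvec q m \<and> real_of_int (zq_norm q g) \<le> \<tau>"
  by (auto simp: honest_triples_def)

lemma finite_honest_triples: "finite (honest_triples n m q \<tau>)"
  unfolding honest_triples_def by (intro finite_cartesian_product finite_Zvec finite_subset[OF _ finite_Zvec[of q m]]) auto

lemma response_Zvec: "g \<in> Zvec q m \<Longrightarrow> response (x, c, g) \<in> Zvec q m"
  unfolding response_def by (auto intro!: redv_in_Zvec q dest: dim_Zvec)

text \<open>The bits recover \<open>x\<close> and \<open>c\<close>, and given these the response
  recovers \<open>g\<close>. Hence no two triples share a label and all amplitudes of the honest
  state are equal.\<close>

lemma inj_on_honest_support: "inj_on (\<lambda>(x, c, g). (vec_bits Q x @ [c], response (x, c, g))) (honest_triples n m q \<tau>)"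
proof (rule inj_onI)
  fix p p' :: "int vec \<times> bool \<times> int vec"
  obtain x c g x' c' g' where p: "p = (x, c, g)" "p' = (x', c', g')" by (cases p; cases p')
  assume "p \<in> honest_triples n m q \<tau>" "p' \<in> honest_triples n m q \<tau>"
    "(case p of (x, c, g) \<Rightarrow> (vec_bits Q x @ [c], response (x, c, g))) =
      (case p' of (x, c, g) \<Rightarrow> (vec_bits Q x @ [c], response (x, c, g)))"
  then have h: "(x, c, g) \<in> honest_triples n m q \<tau>" "(x', c', g') \<in> honest_triples n m q \<tau>"
    and eq: "vec_bits Q x @ [c] = vec_bits Q x' @ [c']" "response (x, c, g) = response (x', c', g')"
    unfolding p by auto
  have "x = x'" using eq(1) h inj_on_vec_bits[OF qQ, of n] by (auto simp: honest_triples_iff inj_on_def)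
  moreover have "c = c'" using eq(1) by simp
  ultimately show "p = p'"
    unfolding p using redv_inj[OF A honest_dims(1) e(1) honest_dims(2,3), of g g' x c] eq(2) h by (auto simp: response_def honest_triples_iff)
qed

lemma honest_state_eq:
  "honest_state n m q Q \<tau> A v = (\<lambda>z. of_bool (z \<in> honest_support) * complex_of_real (1 / sqrt (real (card honest_support))))"
proof
  fix z
  have c: "card honest_support = card (honest_triples n m q \<tau>)"
    unfolding honest_support_def by (rule card_image[OF inj_on_honest_support])
  have "(\<Sum>(x, c, g)\<in>honest_triples n m q \<tau>. ket (vec_bits Q x @ [c], redv q (A *\<^sub>v x - of_bool c \<cdot>\<^sub>v v + g)) z) =
      (\<Sum>p\<in>honest_support. ket p z)"
    unfolding honest_support_def by (subst sum.reindex[OF inj_on_honest_support]) (auto intro!: sum.cong simp: response_def)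
  also have "\<dots> = of_bool (z \<in> honest_support)"
    using finite_honest_triples by (simp add: ket_def honest_support_def of_bool_def)
  finally show "honest_state n m q Q \<tau> A v z = of_bool (z \<in> honest_support) * complex_of_real (1 / sqrt (real (card honest_support)))"
    unfolding honest_state_def c by simp
qed

text \<open>Adding \<open>v\<close> when \<open>c = 1\<close> leaves \<open>A x + g\<close> in both
  cases, and the error \<open>g\<close> is within the tolerance of the inversion.\<close>

lemma inv_response:
  assumes "(x, c, g) \<in> honest_triples n m q \<tau>"
  shows "Inv (if c then redv q (response (x, c, g) + v) else response (x, c, g)) = x"
proof -
  have g: "x \<in> Zvec q n" "g \<in> Zvec q m" "real_of_int (zq_norm q g) \<le> 2 * \<tau>" "dim_vec g = m"
    using assms tau by (auto simp: honest_triples_iff dim_Zvec)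
  show ?thesis
    using inv_correct[OF g(1-3)] honest_shift(3,4)[OF g(4)] by (cases c) (simp_all add: response_def)
qed

lemma honest_support_cases:
  assumes "(z, y) \<in> honest_support"
  shows "z = branch0 y @ [False] \<or> z = branch1 y @ [True]"
proof -
  obtain x c g where h: "(x, c, g) \<in> honest_triples n m q \<tau>" "z = vec_bits Q x @ [c]" "y = response (x, c, g)"
    using assms by (auto simp: honest_support_def)
  show ?thesis using inv_response[OF h(1)] h(2,3) by (cases c) (auto simp: branch0_def branch1_def)
qed

lemma floor_tau_bounds: "2 * \<lfloor>\<tau>\<rfloor> < int q" "0 \<le> \<lfloor>\<tau>\<rfloor>"
proof -
  have "real_of_int (2 * \<lfloor>\<tau>\<rfloor>) \<le> 2 * \<tau>" by simp
  also have "\<dots> < real q" using tau q by simp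
  finally show "2 * \<lfloor>\<tau>\<rfloor> < int q" by linarith
qed (use tau in simp)

lemma redv_add_e: "redv q (redv q (vec m h) + e) = redv q (vec m (\<lambda>i. h i + e $ i))"
  "redv q (redv q (vec m h) - e) = redv q (vec m (\<lambda>i. h i - e $ i))"
  by (intro eq_vecI; simp add: e mod_simps)+

text \<open>Here \<open>y + v\<close> carries the error \<open>g + e\<close>. Both summands are at
  most \<open>\<tau>\<close>, so the tolerance \<open>2 * \<tau>\<close> of the inversion suffices,
  even if \<open>g + e\<close> itself exceeds \<open>\<tau>\<close> and branch 1 is absent.\<close>

lemma inv_shift:
  assumes "(branch0 y @ [False], y) \<in> honest_support"
  shows "Inv (redv q (y + v)) = redv q (Inv y + s)"
proof -
  obtain x g where h: "(x, False, g) \<in> honest_triples n m q \<tau>" "y = response (x, False, g)"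
    using assms by (auto simp: honest_support_def)
  obtain h' where h': "h' \<in> int_box m \<lfloor>\<tau>\<rfloor>" "g = redv q (vec m h')"
    using bij_betw_int_box[OF m refl floor_tau_bounds] h(1) by (auto simp: honest_triples_iff bij_betw_def)
  have x: "x \<in> Zvec q n" "dim_vec x = n" and g: "dim_vec g = m"
    using h by (auto simp: honest_triples_iff dim_Zvec)
  have "real_of_int (zq_norm q (redv q (g + e))) \<le> 2 * \<tau>"
    unfolding h'(2) redv_add_e
  proof (rule zq_norm_redv_le)
    fix i assume "i < dim_vec (vec m (\<lambda>i. h' i + e $ i))"
    then have i: "i < m" by simp
    have "\<bar>real_of_int (h' i)\<bar> \<le> \<tau>" using int_box_index[OF h'(1) i] by linarith
    then show "\<bar>real_of_int (vec m (\<lambda>i. h' i + e $ i) $ i)\<bar> \<le> 2 * \<tau>"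
      using e(2)[OF i] i by simp
  qed (use q m in auto)
  moreover have "redv q (x + s) \<in> Zvec q n" "redv q (g + e) \<in> Zvec q m"
    using x g s e q by (auto intro!: redv_in_Zvec simp: honest_dims)
  moreover have "redv q (y + v) = redv q (A *\<^sub>v redv q (x + s) + redv q (g + e))"
    unfolding h(2) response_def by (simp add: honest_shift(5)[OF x(2) g, simplified])
  ultimately have "Inv (redv q (y + v)) = redv q (x + s)" using inv_correct by simp
  moreover have "Inv y = x" using inv_response[OF h(1)] h(2) by simp
  ultimately show ?thesis by simp
qed

text \<open>The colliding partner has the opposite bit and is shifted by \<open>s\<close> and
  \<open>e\<close>, forwards for \<open>c = 0\<close> and backwards for \<open>c = 1\<close>. It
  lies in the superposition as soon as its error is still within \<open>\<tau>\<close>.\<close>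

lemma good_response:
  assumes x: "x \<in> Zvec q n" and h: "h \<in> int_box m \<lfloor>\<tau>\<rfloor>"
    and good: "\<And>i. i < m \<Longrightarrow> \<bar>h i + (if c then - e $ i else e $ i)\<bar> \<le> \<lfloor>\<tau>\<rfloor>"
  defines "y \<equiv> response (x, c, redv q (vec m h))"
  shows "(branch0 y @ [False], y) \<in> honest_support" "(branch1 y @ [True], y) \<in> honest_support"
proof -
  define g where "g = redv q (vec m h)"
  define x' where "x' = (if c then redv q (x - s) else redv q (x + s))"
  define g' where "g' = (if c then redv q (g - e) else redv q (g + e))"
  have dx: "dim_vec x = n" using x by (simp add: dim_Zvec)
  have "g \<in> {g \<in> Zvec q m. real_of_int (zq_norm q g) \<le> \<tau>}"
    using bij_betw_int_box[OF m refl floor_tau_bounds] h by (auto simp: g_def bij_betw_def)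
  then have g: "(x, c, g) \<in> honest_triples n m q \<tau>" "dim_vec g = m"
    using x by (auto simp: honest_triples_iff dim_Zvec)
  have g'_eq: "g' = redv q (vec m (\<lambda>i. h i + (if c then - e $ i else e $ i)))"
    by (simp add: g'_def g_def redv_add_e)
  have "real_of_int (zq_norm q g') \<le> \<tau>"
    unfolding g'_eq
  proof (rule zq_norm_redv_le)
    fix i assume "i < dim_vec (vec m (\<lambda>i. h i + (if c then - e $ i else e $ i)))"
    then have i: "i < m" by simp
    then show "\<bar>real_of_int (vec m (\<lambda>i. h i + (if c then - e $ i else e $ i)) $ i)\<bar> \<le> \<tau>"
      using good[OF i] by (simp add: le_floor_iff)
  qed (use q m in auto)
  moreover have "x' \<in> Zvec q n" "g' \<in> Zvec q m"
    using dx g s e q by (auto intro!: redv_in_Zvec simp: honest_dims x'_def g'_def)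
  ultimately have g': "(x', \<not> c, g') \<in> honest_triples n m q \<tau>" by (simp add: honest_triples_iff)
  have y: "y = response (x, c, g)" by (simp add: y_def g_def)
  have y': "y = response (x', \<not> c, g')"
    unfolding y response_def x'_def g'_def using honest_shift(1,2)[OF dx g(2)] by (cases c) simp_all
  have "(vec_bits Q x @ [c], y) \<in> honest_support" "(vec_bits Q x' @ [\<not> c], y) \<in> honest_support"
    using g(1) g' y y' unfolding honest_support_def by force+
  then show "(branch0 y @ [False], y) \<in> honest_support" "(branch1 y @ [True], y) \<in> honest_support"
    using honest_support_cases by (cases c; force)+
qed

text \<open>Passing from \<open>x0\<close> to \<open>x1\<close> changes the inner product with
  \<open>a\<close> by \<open>f \<bullet> (A s)\<close>. This cancels against the same term in
  \<open>w\<close>, leaving the accumulated error and the encoded bit.\<close>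

lemma cong_phase:
  assumes f: "dim_vec f = m" and x: "x0 \<in> Zvec q n" "x1 = redv q (x0 + s)"
    and a: "a = redv q (A\<^sup>T *\<^sub>v f)" and w: "w = (f \<bullet> v + k) mod int q"
  shows "[w - (\<Sum>i<n. a $ i * x1 $ i) + (\<Sum>i<n. a $ i * x0 $ i) = f \<bullet> e + k] (mod int q)"
proof -
  have dx: "dim_vec x0 = n" using x by (simp add: dim_Zvec)
  have "[(\<Sum>i<n. a $ i * x1 $ i) = (\<Sum>i<n. a $ i * (x0 $ i + s $ i))] (mod int q)"
    unfolding x using dx honest_dims by (intro cong_sum cong_mult) (auto simp: cong_def)
  then have "[(\<Sum>i<n. a $ i * x1 $ i) - (\<Sum>i<n. a $ i * x0 $ i) =
      (\<Sum>i<n. a $ i * (x0 $ i + s $ i)) - (\<Sum>i<n. a $ i * x0 $ i)] (mod int q)"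
    by (intro cong_diff) auto
  also have "(\<Sum>i<n. a $ i * (x0 $ i + s $ i)) - (\<Sum>i<n. a $ i * x0 $ i) = (\<Sum>i<n. a $ i * s $ i)"
    by (simp add: algebra_simps sum.distrib)
  also have "[\<dots> = (\<Sum>i<n. (A\<^sup>T *\<^sub>v f) $ i * s $ i)] (mod int q)"
    using A unfolding a by (intro cong_sum cong_mult) (auto simp: cong_def)
  also have "(\<Sum>i<n. (A\<^sup>T *\<^sub>v f) $ i * s $ i) = (A\<^sup>T *\<^sub>v f) \<bullet> s"
    using honest_dims by (simp add: scalar_prod_def lessThan_atLeast0)
  also have "\<dots> = f \<bullet> (A *\<^sub>v s)"
    using A f honest_dims by (intro transpose_vec_mult_scalar) (auto intro: carrier_vecI)
  finally have 1: "[(\<Sum>i<n. a $ i * x1 $ i) - (\<Sum>i<n. a $ i * x0 $ i) = f \<bullet> (A *\<^sub>v s)] (mod int q)" .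
  have "[f \<bullet> v = f \<bullet> (A *\<^sub>v s + e)] (mod int q)"
    unfolding v using cong_scalar_prod_redv[of "A *\<^sub>v s + e" f q] f e by simp
  also have "f \<bullet> (A *\<^sub>v s + e) = f \<bullet> (A *\<^sub>v s) + f \<bullet> e"
    by (rule scalar_prod_add_distrib[of _ m]) (use A f e in \<open>auto intro: carrier_vecI\<close>)
  finally have "[f \<bullet> v + k = f \<bullet> (A *\<^sub>v s) + f \<bullet> e + k] (mod int q)" by (intro cong_add) auto
  then have 2: "[w = f \<bullet> (A *\<^sub>v s) + f \<bullet> e + k] (mod int q)" by (simp add: w cong_def)
  show ?thesis using cong_diff[OF 2 1] by (simp add: algebra_simps)
qed

text \<open>Applies \<open>qubit_game\<close> to the state left by the response. If a branch is
  missing, the interference term vanishes and success has probability 1/2.\<close>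

lemma success_given_response:
  assumes y: "y \<in> Zvec q m" and z: "(z, y) \<in> honest_support"
    and f: "dim_vec f = m" and a: "a = redv q (A\<^sup>T *\<^sub>v f)" and w: "w = (f \<bullet> v + k) mod int q"
  shows "pmf (measure_qubits (zip [0..<n * Q] (map xy_obs (bob_angles n q Q a)))
        (normalize_state (\<lambda>b. of_bool ((b, y) \<in> honest_support))) \<bind>
      (\<lambda>(us, \<psi>). map_pmf (\<lambda>d. (bdot us (bxor (branch0 y) (branch1 y)) \<noteq> d) \<longleftrightarrow> S)
        (map_pmf fst (measure_qubit (xy_obs \<xi>) (n * Q)
          (phase_gate (2 * pi * real_of_int w / real q) (n * Q) \<psi>))))) True =
    1 / 2 + of_bool ((branch0 y @ [False], y) \<in> honest_support \<and> (branch1 y @ [True], y) \<in> honest_support) / 2 *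
      ((-1) ^ of_bool S * cos (2 * pi / real q * real_of_int (f \<bullet> e + k) - \<xi>))"
proof -
  define P where "P \<longleftrightarrow> (branch0 y @ [False], y) \<in> honest_support \<and> (branch1 y @ [True], y) \<in> honest_support"
  define x0 where "x0 = Inv y"
  define x1 where "x1 = Inv (redv q (y + v))"
  have x: "x0 \<in> Zvec q n" "x1 \<in> Zvec q n"
    unfolding x0_def x1_def using y q by (auto intro!: inv_range redv_in_Zvec simp: honest_dims)
  then have dx: "dim_vec x0 = n" "dim_vec x1 = n" by (simp_all add: dim_Zvec)
  have X: "branch0 y = vec_bits Q x0" "branch1 y = vec_bits Q x1" by (simp_all add: branch0_def branch1_def x0_def x1_def)
  have len: "length (branch0 y) = length (bob_angles n q Q a)" "length (branch1 y) = length (bob_angles n q Q a)"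
    by (simp_all add: X dx)
  define S' where "S' = {b. (b, y) \<in> honest_support}"
  have S': "S' \<subseteq> {branch0 y @ [False], branch1 y @ [True]}" "S' \<noteq> {}"
    using z honest_support_cases by (auto simp: S'_def)
  obtain \<alpha> \<beta> where st: "normalize_state (\<lambda>b. of_bool (b \<in> S')) = two_branch \<alpha> \<beta> (branch0 y @ [False]) (branch1 y @ [True])"
    and n1: "(cmod \<alpha>)\<^sup>2 + (cmod \<beta>)\<^sup>2 = 1"
    and ab: "cnj \<alpha> * \<beta> = of_bool (branch0 y @ [False] \<in> S' \<and> branch1 y @ [True] \<in> S') / 2"
    by (rule normalize_indicator_two_branch[OF S']) simp_all
  define D where "D = (\<Sum>(r, x, y)\<leftarrow>zip (bob_angles n q Q a) (zip (branch0 y) (branch1 y)). r * (of_bool y - of_bool x) :: real)"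
  have D: "D = 2 * pi / real q * real_of_int (\<Sum>i<n. a $ i * x1 $ i) - 2 * pi / real q * real_of_int (\<Sum>i<n. a $ i * x0 $ i)"
    unfolding D_def by (subst sum_list_angles_diff) (simp_all add: X dx sum_list_bob_angles[OF _ qQ] x)
  have rot: "2 * pi * real_of_int w / real q - \<xi> - D =
      2 * pi / real q * real_of_int (w - (\<Sum>i<n. a $ i * x1 $ i) + (\<Sum>i<n. a $ i * x0 $ i)) - \<xi>"
    unfolding D by (simp add: algebra_simps)
  have "Re (cnj \<alpha> * \<beta> * cis (2 * pi * real_of_int w / real q - \<xi> - D)) =
      of_bool P / 2 * cos (2 * pi / real q * real_of_int (f \<bullet> e + k) - \<xi>)"
  proof (cases P)
    case True
    \<comment> \<open>The phase has to be known only when both branches occur, and then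
      \<open>inv_shift\<close> supplies the relation between them.\<close>
    then have "x1 = redv q (x0 + s)" unfolding P_def x0_def x1_def by (intro inv_shift) auto
    from cis_cong[OF cong_phase[OF f x(1) this a w] q]
    show ?thesis using True unfolding ab rot by (simp add: P_def S'_def)
  next
    case False
    then show ?thesis unfolding ab by (auto simp: P_def S'_def)
  qed
  moreover note qubit_game[OF len n1, of S \<xi> "2 * pi * real_of_int w / real q", folded D_def]
  ultimately show ?thesis
    unfolding st[unfolded S'_def mem_Collect_eq] P_def[symmetric] by simp
qed

abbreviation (input) honest_params :: "(int vec \<times> bool \<times> (nat \<Rightarrow> int)) set" where
  "honest_params \<equiv> Zvec q n \<times> UNIV \<times> int_box m \<lfloor>\<tau>\<rfloor>"

lemma bij_betw_honest_support:
  "bij_betw (\<lambda>(x, c, h). (vec_bits Q x @ [c], response (x, c, redv q (vec m h)))) honest_params honest_support"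
proof -
  have 1: "bij_betw (map_prod id (map_prod id (\<lambda>h. redv q (vec m h)))) honest_params (honest_triples n m q \<tau>)"
    unfolding honest_triples_def
    by (intro bij_betw_map_prod bij_betw_int_box[OF m refl floor_tau_bounds]) (auto simp: bij_betw_def)
  have 2: "(\<lambda>(x, c, g). (vec_bits Q x @ [c], response (x, c, g))) \<circ> map_prod id (map_prod id (\<lambda>h. redv q (vec m h))) =
      (\<lambda>(x, c, h). (vec_bits Q x @ [c], response (x, c, redv q (vec m h))))"
    by (auto simp: fun_eq_iff)
  show ?thesis
    using bij_betw_trans[OF 1 inj_on_imp_bij_betw[OF inj_on_honest_support]] unfolding 2 honest_support_def .
qed

lemma finite_int_box: "finite (int_box k T)"
  unfolding int_box_def by (intro finite_PiE) auto

lemma finite_nonempty_honest_params: "finite honest_params" "honest_params \<noteq> {}"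
proof -
  show "finite honest_params" by (intro finite_cartesian_product finite_Zvec finite_int_box) auto
  have "restrict (\<lambda>_. 0) {..<m} \<in> int_box m \<lfloor>\<tau>\<rfloor>"
    unfolding int_box_def restrict_PiE_iff using floor_tau_bounds(2) by simp
  then show "honest_params \<noteq> {}" using Zvec_nonempty[OF q] by auto
qed

text \<open>A union bound over the coordinates. The count for one coordinate depends only on the
  absolute value of the shift, so both values of \<open>c\<close> obey the same bound.\<close>

lemma card_bad_params:
  "real (card {(x, c, h) \<in> honest_params. \<exists>i<m. \<bar>h i + (if c then - e $ i else e $ i)\<bar> > \<lfloor>\<tau>\<rfloor>}) / real (card honest_params)
    \<le> (\<Sum>i<m. \<bar>real_of_int (e $ i)\<bar>) / (2 * real_of_int \<lfloor>\<tau>\<rfloor> + 1)"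
proof -
  define T where "T = \<lfloor>\<tau>\<rfloor>"
  have T: "T \<ge> 0" using floor_tau_bounds by (simp add: T_def)
  define bad where "bad = (\<lambda>i c. {h \<in> int_box m T. \<bar>h i + (if c then - e $ i else e $ i)\<bar> > T})"
  have fin: "finite (bad i c)" for i c
    unfolding bad_def by (rule finite_subset[OF _ finite_int_box[of m T]]) auto
  define N where "N = real (card (int_box m T))"
  have b: "real (card (bad i c)) \<le> N * \<bar>real_of_int (e $ i)\<bar> / (2 * real_of_int T + 1)" if "i < m" for i c
    using card_int_box_shift_le[OF T that, of "if c then - e $ i else e $ i"] unfolding bad_def N_def
    by (cases c) auto
  have card_params: "real (card honest_params) = real (card (Zvec q n)) * 2 * N"
    by (simp add: card_cartesian_product N_def T_def UNIV_bool)
  have "{(x, c, h) \<in> honest_params. \<exists>i<m. \<bar>h i + (if c then - e $ i else e $ i)\<bar> > \<lfloor>\<tau>\<rfloor>} =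
      (\<Union>i<m. SIGMA x:Zvec q n. SIGMA c:UNIV. bad i c)"
    by (auto simp: bad_def T_def)
  then have "card {(x, c, h) \<in> honest_params. \<exists>i<m. \<bar>h i + (if c then - e $ i else e $ i)\<bar> > \<lfloor>\<tau>\<rfloor>} \<le>
      (\<Sum>i<m. card (SIGMA x:Zvec q n. SIGMA c:UNIV. bad i c))"
    using card_UN_le[of "{..<m}"] by simp
  also have "\<dots> = (\<Sum>i<m. card (Zvec q n) * (card (bad i False) + card (bad i True)))"
    by (simp add: finite_Zvec fin UNIV_bool add.commute)
  finally have "real (card {(x, c, h) \<in> honest_params. \<exists>i<m. \<bar>h i + (if c then - e $ i else e $ i)\<bar> > \<lfloor>\<tau>\<rfloor>}) \<le>
      real (\<Sum>i<m. card (Zvec q n) * (card (bad i False) + card (bad i True)))"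
    by (simp only: of_nat_le_iff)
  also have "\<dots> = (\<Sum>i<m. real (card (Zvec q n)) * (real (card (bad i False)) + real (card (bad i True))))"
    by simp
  also have "\<dots> \<le> (\<Sum>i<m. real (card (Zvec q n)) * (2 * (N * \<bar>real_of_int (e $ i)\<bar> / (2 * real_of_int T + 1))))"
    using b[of _ False] b[of _ True] by (intro sum_mono mult_left_mono) force+
  also have "\<dots> = (\<Sum>i<m. real (card honest_params) * (\<bar>real_of_int (e $ i)\<bar> / (2 * real_of_int T + 1)))"
    unfolding card_params by (simp add: mult_ac)
  also have "\<dots> = real (card honest_params) * ((\<Sum>i<m. \<bar>real_of_int (e $ i)\<bar>) / (2 * real_of_int T + 1))"
    by (simp only: sum_distrib_left sum_divide_distrib)
  finally have le: "real (card {(x, c, h) \<in> honest_params. \<exists>i<m. \<bar>h i + (if c then - e $ i else e $ i)\<bar> > \<lfloor>\<tau>\<rfloor>}) \<le>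
      real (card honest_params) * ((\<Sum>i<m. \<bar>real_of_int (e $ i)\<bar>) / (2 * real_of_int \<lfloor>\<tau>\<rfloor> + 1))"
    by (simp only: T_def)
  have "0 < real (card honest_params)"
    using finite_nonempty_honest_params by (simp only: of_nat_0_less_iff card_gt_0_iff) simp
  with le show ?thesis by (simp only: pos_divide_le_eq mult.commute)
qed

text \<open>There are two losses: the deviation of the phase from \<open>b * pi / 2\<close>, and the
  chance that a branch is missing, which costs at most \<open>sqrt 2 / 4\<close>, the ideal
  advantage over 1/2.\<close>

lemma success_bound:
  assumes f: "f \<in> Zvec 2 m" and a: "a = redv q (A\<^sup>T *\<^sub>v f)"
    and w: "w = (f \<bullet> v + of_bool b * \<lfloor>real q / 4\<rfloor>) mod int q"
  defines "E \<equiv> \<Sum>i<m. \<bar>real_of_int (e $ i)\<bar>"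
  shows "1 / 2 + sqrt 2 / 4 - pi / real q * (E + 1) - sqrt 2 / 4 * (E / (2 * real_of_int \<lfloor>\<tau>\<rfloor> + 1)) \<le>
    pmf (honest_bob\<^sub>1 n m q Q \<tau> (A, v) (a, w) \<bind> (\<lambda>((y, u), st). honest_bob\<^sub>2 n Q st b' \<bind>
      (\<lambda>d. return_pmf ((bdot u (bxor (vec_bits Q (Inv y)) (vec_bits Q (Inv (redv q (y + v))))) \<noteq> d) \<longleftrightarrow> (b \<and> b'))))) True"
proof -
  define k where "k = of_bool b * \<lfloor>real q / 4\<rfloor>"
  define \<xi> where "\<xi> = (-1) ^ of_bool b' * pi / 4"
  define \<theta> where "\<theta> = 2 * pi * real_of_int w / real q"
  define c where "c = 1 / 2 + sqrt 2 / 4 - pi / real q * (E + 1)"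
  define G' where "G' = (\<lambda>y \<phi>. measure_qubits (zip [0..<n * Q] (map xy_obs (bob_angles n q Q a))) \<phi> \<bind>
      (\<lambda>(us, \<psi>). map_pmf (\<lambda>d. (bdot us (bxor (branch0 y) (branch1 y)) \<noteq> d) \<longleftrightarrow> (b \<and> b'))
        (map_pmf fst (measure_qubit (xy_obs \<xi>) (n * Q) (phase_gate \<theta> (n * Q) \<psi>)))))"
  define G where "G = (\<lambda>y. G' y (normalize_state (\<lambda>b. of_bool ((b, y) \<in> honest_support))))"
  define rsp where "rsp = (\<lambda>(x, c, h). response (x, c, redv q (vec m h)))"
  note surj = bij_betw_imp_surj_on[OF bij_betw_honest_support, symmetric]
  have fin: "finite honest_support"
    unfolding surj by (rule finite_imageI[OF finite_nonempty_honest_params(1)])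
  have ne: "honest_support \<noteq> {}"
    unfolding surj image_is_empty by (rule finite_nonempty_honest_params(2))
  \<comment> \<open>The first measurement becomes classical: draw \<open>(x, c, h)\<close> uniformly
    and play the qubit game at its response.\<close>
  have "honest_bob\<^sub>1 n m q Q \<tau> (A, v) (a, w) \<bind> (\<lambda>((y, u), st). honest_bob\<^sub>2 n Q st b' \<bind>
      (\<lambda>d. return_pmf ((bdot u (bxor (vec_bits Q (Inv y)) (vec_bits Q (Inv (redv q (y + v))))) \<noteq> d) \<longleftrightarrow> (b \<and> b')))) =
    measure_snd (honest_state n m q Q \<tau> A v) \<bind> (\<lambda>(y, \<phi>). G' y \<phi>)"
    unfolding honest_bob\<^sub>1_def honest_bob\<^sub>2_def bob_measurements G'_def \<xi>_def \<theta>_def branch0_def branch1_def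
    by (simp add: bind_assoc_pmf bind_return_pmf case_prod_unfold map_pmf_def)
  also have "\<dots> = pmf_of_set honest_support \<bind> (\<lambda>p. G (snd p))"
    unfolding honest_state_eq measure_snd_uniform[OF fin ne] bind_map_pmf G_def by (simp add: case_prod_unfold)
  also have "\<dots> = pmf_of_set honest_params \<bind> (\<lambda>p. G (rsp p))"
    unfolding map_pmf_of_set_bij_betw[OF bij_betw_honest_support finite_nonempty_honest_params(2,1), symmetric] bind_map_pmf
    by (intro bind_pmf_cong refl) (auto simp: rsp_def)
  finally have eq: "honest_bob\<^sub>1 n m q Q \<tau> (A, v) (a, w) \<bind> (\<lambda>((y, u), st). honest_bob\<^sub>2 n Q st b' \<bind>
      (\<lambda>d. return_pmf ((bdot u (bxor (vec_bits Q (Inv y)) (vec_bits Q (Inv (redv q (y + v))))) \<noteq> d) \<longleftrightarrow> (b \<and> b')))) =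
    pmf_of_set honest_params \<bind> (\<lambda>p. G (rsp p))" .
  have df: "dim_vec f = m" using f by (simp add: dim_Zvec)
  define X where "X = (-1) ^ of_bool (b \<and> b') * cos (2 * pi / real q * real_of_int (f \<bullet> e + k) - \<xi>)"
  have G: "pmf (G (rsp (x, c, h))) True = 1 / 2 + of_bool ((branch0 (rsp (x, c, h)) @ [False], rsp (x, c, h)) \<in> honest_support \<and>
      (branch1 (rsp (x, c, h)) @ [True], rsp (x, c, h)) \<in> honest_support) / 2 * X"
    if "(x, c, h) \<in> honest_params" for x c h
    unfolding G_def G'_def \<theta>_def X_def
  proof (rule success_given_response[OF _ _ df a w[folded k_def]])
    show "(vec_bits Q x @ [c], rsp (x, c, h)) \<in> honest_support"
      using bspec[OF bij_betwE[OF bij_betw_honest_support] that] by (simp add: rsp_def)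
    show "rsp (x, c, h) \<in> Zvec q m" unfolding rsp_def by (auto intro!: response_Zvec redv_in_Zvec q)
  qed
  have X: "2 * (c - 1 / 2) \<le> X"
  proof -
    define \<delta> where "\<delta> = 2 * pi / real q * (real_of_int (f \<bullet> e) + of_bool b * (real_of_int \<lfloor>real q / 4\<rfloor> - real q / 4))"
    have ang: "2 * pi / real q * real_of_int (f \<bullet> e + k) = of_bool b * (pi / 2) + \<delta>"
      using q by (cases b) (simp_all add: \<delta>_def k_def field_simps)
    have "\<bar>real_of_int (f \<bullet> e)\<bar> \<le> E"
    proof -
      have "\<bar>real_of_int (f \<bullet> e)\<bar> = \<bar>\<Sum>i<m. real_of_int (f $ i) * real_of_int (e $ i)\<bar>"
        using e by (simp add: scalar_prod_def lessThan_atLeast0)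
      also have "\<dots> \<le> (\<Sum>i<m. \<bar>real_of_int (f $ i) * real_of_int (e $ i)\<bar>)"
        by (rule sum_abs)
      also have "\<dots> \<le> E"
        unfolding E_def
      proof (rule sum_mono)
        fix i assume "i \<in> {..<m}"
        then have "f $ i = 0 \<or> f $ i = 1" using Zvec_index[OF f, of i] by auto
        then show "\<bar>real_of_int (f $ i) * real_of_int (e $ i)\<bar> \<le> \<bar>real_of_int (e $ i)\<bar>" by auto
      qed
      finally show ?thesis .
    qed
    \<comment> \<open>Rounding \<open>q / 4\<close> down is the source of the \<open>1\<close> in
      \<open>E + 1\<close>.\<close>
    moreover have "\<bar>of_bool b * (real_of_int \<lfloor>real q / 4\<rfloor> - real q / 4)\<bar> \<le> 1"
      by (cases b) (simp_all, linarith)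
    ultimately have "\<bar>real_of_int (f \<bullet> e) + of_bool b * (real_of_int \<lfloor>real q / 4\<rfloor> - real q / 4)\<bar> \<le> E + 1"
      by linarith
    then have "\<bar>\<delta>\<bar> \<le> 2 * pi / real q * (E + 1)"
      unfolding \<delta>_def abs_mult by (intro mult_mono) auto
    moreover have "sqrt 2 / 2 - \<bar>\<delta>\<bar> \<le> X"
      unfolding X_def ang \<xi>_def by (rule chsh_angle)
    ultimately show ?thesis by (simp add: c_def)
  qed
  define Bad where "Bad = {(x, c, h) \<in> honest_params. \<exists>i<m. \<bar>h i + (if c then - e $ i else e $ i)\<bar> > \<lfloor>\<tau>\<rfloor>}"
  have "c - sqrt 2 / 4 * (real (card Bad) / real (card honest_params)) \<le> pmf (pmf_of_set honest_params \<bind> (\<lambda>p. G (rsp p))) True"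
  proof (rule pmf_bind_pmf_of_set_ge[OF finite_nonempty_honest_params])
    show "Bad \<subseteq> honest_params" by (auto simp: Bad_def)
    fix p :: "int vec \<times> bool \<times> (nat \<Rightarrow> int)"
    obtain x d h where p: "p = (x, d, h)" by (cases p)
    {
      assume "p \<in> honest_params" "p \<notin> Bad"
      then have h: "x \<in> Zvec q n" "h \<in> int_box m \<lfloor>\<tau>\<rfloor>"
        "\<And>i. i < m \<Longrightarrow> \<bar>h i + (if d then - e $ i else e $ i)\<bar> \<le> \<lfloor>\<tau>\<rfloor>"
        by (auto simp: p Bad_def not_less) (meson not_le)+
      have "pmf (G (rsp p)) True = 1 / 2 + X / 2"
        unfolding p using good_response[OF h] by (subst G) (use h in \<open>auto simp: rsp_def\<close>)
      then show "c \<le> pmf (G (rsp p)) True" using X by simp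
    }
    {
      assume "p \<in> Bad"
      then have h: "(x, d, h) \<in> honest_params" by (auto simp: p Bad_def)
      \<comment> \<open>A bad parameter may still leave both branches, so two values are compared:
        1/2 when a branch is missing, and \<open>1 / 2 + X / 2\<close> otherwise.\<close>
      have "c - sqrt 2 / 4 \<le> 1 / 2"
        unfolding c_def by (simp add: E_def sum_nonneg)
      moreover have "0 \<le> sqrt 2 / 4" by simp
      with X have "c - sqrt 2 / 4 \<le> 1 / 2 + X / 2" by argo
      ultimately show "c - sqrt 2 / 4 \<le> pmf (G (rsp p)) True"
        unfolding p G[OF h] by (auto simp: of_bool_def)
    }
  qed
  moreover have "sqrt 2 / 4 * (real (card Bad) / real (card honest_params)) \<le> sqrt 2 / 4 * (E / (2 * real_of_int \<lfloor>\<tau>\<rfloor> + 1))"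
    unfolding Bad_def E_def by (intro mult_left_mono card_bad_params) simp
  ultimately show ?thesis unfolding eq c_def by linarith
qed

end

section \<open>The success probability\<close>

lemma expectation_sum_list_tgauss:
  assumes "\<sigma> \<ge> 1" "t \<ge> 0"
  shows "measure_pmf.expectation (replicate_pmf m (tgauss \<sigma> t)) (\<lambda>l. \<Sum>x\<leftarrow>l. real_of_int \<bar>x\<bar>) \<le> real m * (4 / 3 * \<sigma>)"
  unfolding expectation_replicate_pmf_sum_list[OF tgauss_bounds(2)[OF assms]]
  by (intro mult_left_mono tgauss_bounds(3)[OF assms]) simp

text \<open>For \<open>\<tau> < 1\<close> the loss is 0 by assumption, which the application meets
  because integer errors below 1 vanish. Otherwise the floor is at least 1 and exceeds
  \<open>\<tau> - 1\<close>; half of the first bound and 3/2 of the second give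
  \<open>3 / 2 * \<tau>\<close>.\<close>

lemma shift_loss:
  assumes "0 \<le> \<tau>" "E \<ge> 0" "\<tau> < 1 \<Longrightarrow> E = 0"
  shows "E / (2 * real_of_int \<lfloor>\<tau>\<rfloor> + 1) \<le> 2 / 3 * (E / \<tau>)"
proof (cases "\<tau> < 1")
  case False
  then have "1 \<le> \<lfloor>\<tau>\<rfloor>" by simp
  then have "1 \<le> real_of_int \<lfloor>\<tau>\<rfloor>" by linarith
  then have "2 * real_of_int \<lfloor>\<tau>\<rfloor> + 1 \<ge> 3 / 2 * \<tau>"
    using real_of_int_floor_add_one_gt[of \<tau>] by linarith
  then have "E / (2 * real_of_int \<lfloor>\<tau>\<rfloor> + 1) \<le> E / (3 / 2 * \<tau>)"
    using assms False by (intro divide_left_mono) auto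
  then show ?thesis by simp
qed (use assms in simp)

text \<open>The budget is split in units of \<open>m * \<sigma> / \<tau>\<close>. The phase loss
  takes at most 1/8, since it is at most \<open>5 * m * \<sigma> / q\<close> and
  \<open>m * Q \<ge> 10\<close>; the branch loss takes \<open>2 / 9 * sqrt 2\<close>, which is below
  3/8.\<close>

lemma total_loss:
  fixes m Q q \<sigma> \<tau> :: real
  assumes "q > 0" "\<sigma> \<ge> 1" "m \<ge> 5" "Q \<ge> 2" "\<tau> = q / (4 * m * Q)"
  shows "pi / q * (m * (4 / 3 * \<sigma>) + 1) + sqrt 2 / 4 * (2 / 3 * (m * (4 / 3 * \<sigma>) / \<tau>)) \<le> m * \<sigma> / (2 * \<tau>)"
proof -
  have s2: "sqrt 2 \<le> 1.4143" by (rule real_le_lsqrt) (auto simp: power2_eq_square)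
  have ms: "m * \<sigma> \<ge> 5" using mult_mono[of 5 m 1 \<sigma>] assms by simp
  have mQ: "m * Q \<ge> 10" using mult_mono[of 5 m 2 Q] assms by simp
  have "pi * (m * (4 / 3 * \<sigma>) + 1) \<le> 3.1416 * (m * (4 / 3 * \<sigma>) + 1)"
    using pi_approx assms ms by (intro mult_right_mono) auto
  also have "\<dots> \<le> 5 * (m * \<sigma>)" using ms by (simp add: mult.commute[of m])
  finally have 1: "pi * (m * (4 / 3 * \<sigma>) + 1) \<le> 5 * (m * \<sigma>)" .
  have t: "m * \<sigma> / \<tau> = 4 * (m * Q) * (m * \<sigma>) / q" using assms by simp
  have "5 * (m * \<sigma>) \<le> (1 / 8 * (4 * (m * Q))) * (m * \<sigma>)"
    by (rule mult_right_mono) (use mQ ms in linarith)+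
  from divide_right_mono[OF order_trans[OF 1 this], of q] assms(1)
  have "pi * (m * (4 / 3 * \<sigma>) + 1) / q \<le> (1 / 8 * (4 * (m * Q))) * (m * \<sigma>) / q" by linarith
  then have 2: "pi / q * (m * (4 / 3 * \<sigma>) + 1) \<le> 1 / 8 * (m * \<sigma> / \<tau>)"
    unfolding t by (simp add: mult_ac)
  have "\<tau> > 0" using assms by simp
  then have p: "m * \<sigma> / \<tau> \<ge> 0" using assms ms by simp
  have "sqrt 2 / 4 * (2 / 3 * (m * (4 / 3 * \<sigma>) / \<tau>)) = sqrt 2 * (2 / 9) * (m * \<sigma> / \<tau>)" by simp
  also have "\<dots> \<le> 3 / 8 * (m * \<sigma> / \<tau>)"
    using s2 p by (intro mult_right_mono) auto
  finally show ?thesis using 2 by simp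
qed

theorem theorem5p1:
  fixes n m q Q :: "nat \<Rightarrow> nat" and \<sigma> \<tau> :: "nat \<Rightarrow> real"
    and GenTrap :: "nat \<Rightarrow> (int mat \<times> bool list) pmf"
    and Invert :: "nat \<Rightarrow> int mat \<Rightarrow> int vec \<Rightarrow> bool list \<Rightarrow> int vec"
    and lam :: nat
  assumes log_q: "poly_bounded (\<lambda>k. log 2 (real (q k)))"
    and log_sigma: "poly_bounded (\<lambda>k. log 2 (\<sigma> k))"
    and sigma: "\<And>k. 1 \<le> k \<Longrightarrow> 1 \<le> \<sigma> k"
    and q: "\<And>k. 1 \<le> k \<Longrightarrow> prime (q k) \<and> odd (q k)"
    and Q: "\<And>k. 1 \<le> k \<Longrightarrow> Q k = nat \<lceil>log 2 (real (q k))\<rceil>"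
    and n: "\<And>k. 1 \<le> k \<Longrightarrow> n k = k"
    and m: "\<And>k. 1 \<le> k \<Longrightarrow> m k = n k * (2 * Q k + 1)"
    and tau: "\<And>k. 1 \<le> k \<Longrightarrow> \<tau> k = real (q k) / (4 * real (m k) * real (Q k))"
    and GenTrap_ppt: "ppt_gen q Q GenTrap"
    and Invert_polytime: "polytime_inv n m q Q Invert"
    and Invert_range: "\<And>k A y t. 1 \<le> k \<Longrightarrow> A \<in> Zmat (q k) (m k) (n k) \<Longrightarrow>
      y \<in> Zvec (q k) (m k) \<Longrightarrow> Invert k A y t \<in> Zvec (q k) (n k)"
    and GenTrap_range: "\<And>k A t. 1 \<le> k \<Longrightarrow> (A, t) \<in> set_pmf (GenTrap k) \<Longrightarrow>
      A \<in> Zmat (q k) (m k) (n k)"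
    and GenTrap_uniform: "\<And>k. 1 \<le> k \<Longrightarrow>
      stat_dist (map_pmf fst (GenTrap k)) (pmf_of_set (Zmat (q k) (m k) (n k)))
        \<le> real (n k) * real (Q k) * 2 powr (- real (n k) / 2)"
    and Invert_correct: "\<And>k A t s e. 1 \<le> k \<Longrightarrow> (A, t) \<in> set_pmf (GenTrap k) \<Longrightarrow>
      s \<in> Zvec (q k) (n k) \<Longrightarrow> e \<in> Zvec (q k) (m k) \<Longrightarrow>
      real_of_int (zq_norm (q k) e) \<le> 2 * \<tau> k \<Longrightarrow>
      Invert k A (redv (q k) (A *\<^sub>v s + e)) t = s"
    and lam: "1 \<le> lam"
  shows "pmf (protocol_Q (n lam) (m lam) (q lam) (Q lam) (\<sigma> lam) (\<tau> lam) (GenTrap lam) (Invert lam)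
           (honest_bob\<^sub>1 (n lam) (m lam) (q lam) (Q lam) (\<tau> lam)) (honest_bob\<^sub>2 (n lam) (Q lam))) True
       \<ge> (cos (pi / 8))\<^sup>2 - 5 * real (m lam) * (\<sigma> lam)\<^sup>2 / (real (q lam))\<^sup>2
           - real (m lam) * \<sigma> lam / (2 * \<tau> lam)"
proof -
  define N where "N = n lam"
  define M where "M = m lam"
  define p where "p = q lam"
  define R where "R = Q lam"
  define t where "t = \<tau> lam"
  note defs = N_def M_def p_def R_def t_def
  have p: "prime p" "odd p" using q[OF lam] by (auto simp: p_def)
  have p3: "p \<ge> 3" using p prime_ge_2_nat[of p] by (cases "p = 2") auto
  have R: "R = nat \<lceil>log 2 (real p)\<rceil>" using Q[OF lam] by (simp add: defs)
  have pR: "p \<le> 2 ^ R"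
  proof -
    have "real p = 2 powr log 2 (real p)" using p3 by simp
    also have "\<dots> \<le> 2 powr real R" unfolding R using p3 by (intro powr_mono) auto
    also have "\<dots> = real (2 ^ R)" by (simp add: powr_realpow)
    finally show ?thesis by linarith
  qed
  have R2: "R \<ge> 2"
  proof (rule ccontr)
    assume "\<not> R \<ge> 2"
    then have "(2::nat) ^ R \<le> 2 ^ 1" by (intro power_increasing) auto
    then show False using pR p3 by simp
  qed
  have "M = N * (2 * R + 1)" "N \<ge> 1" using m[OF lam] n[OF lam] lam by (simp_all add: defs)
  then have M5: "M \<ge> 5" using R2 mult_le_mono[of 1 N 5 "2 * R + 1"] by simp
  have t: "t = real p / (4 * real M * real R)" using tau[OF lam] by (simp add: defs)
  have MR: "real M * real R \<ge> 10" using mult_mono[of 5 "real M" 2 "real R"] M5 R2 by simp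
  have t0: "t > 0" using t p3 M5 R2 by simp
  have "4 * t = real p / (real M * real R)" unfolding t by simp
  also have "\<dots> \<le> real p" using MR p3 by (simp add: divide_le_eq)
  finally have t4: "4 * t \<le> real p" .
  have sg: "\<sigma> lam \<ge> 1" using sigma[OF lam] .
  \<comment> \<open>\<open>loss\<close> is affine in the total error \<open>E\<close>, so averaging
    over \<open>e\<close> requires only the expectation of \<open>E\<close>.\<close>
  define loss where "loss = (\<lambda>E. pi / real p * (E + 1) + sqrt 2 / 4 * (2 / 3 * (E / t)))"
  define L where "L = 1 / 2 + sqrt 2 / 4 - loss (real M * (4 / 3 * \<sigma> lam))"
  have "L \<le> pmf (protocol_Q N M p R (\<sigma> lam) t (GenTrap lam) (Invert lam)
           (honest_bob\<^sub>1 N M p R t) (honest_bob\<^sub>2 N R)) True"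
    unfolding protocol_Q_def Let_def
  proof (rule pmf_bind_ge)
    fix s assume "s \<in> set_pmf (pmf_of_set (Zvec p N))"
    then have s: "s \<in> Zvec p N" using Zvec_nonempty[of p N] p3 by (simp add: finite_Zvec)
    \<comment> \<open>All that follows the choice of \<open>e\<close>. The error is the one sample
      that gets averaged; for the others a bound at every value is enough.\<close>
    define rest where "rest = (\<lambda>e. GenTrap lam \<bind> (\<lambda>(A, tr). coin \<bind> (\<lambda>b. pmf_of_set (Zvec 2 M) \<bind> (\<lambda>f.
      honest_bob\<^sub>1 N M p R t (A, redv p (A *\<^sub>v s + e))
        (redv p (A\<^sup>T *\<^sub>v f), (f \<bullet> redv p (A *\<^sub>v s + e) + of_bool b * \<lfloor>real p / 4\<rfloor>) mod int p) \<bind>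
      (\<lambda>((y, u), st). coin \<bind> (\<lambda>b'. honest_bob\<^sub>2 N R st b' \<bind> (\<lambda>d'.
        return_pmf ((bdot u (bxor (vec_bits R (Invert lam A y tr))
          (vec_bits R (Invert lam A (redv p (y + redv p (A *\<^sub>v s + e))) tr))) \<noteq> d') = (b \<and> b')))))))))"
    have rest: "1 / 2 + sqrt 2 / 4 - loss (\<Sum>x\<leftarrow>l. real_of_int \<bar>x\<bar>) \<le> pmf (rest (redv p (vec_of_list l))) True"
      if l: "l \<in> set_pmf (replicate_pmf M (tgauss (\<sigma> lam) t))" for l
    proof -
      define e where "e = vec_of_list l"
      have len: "length l = M" and lt: "\<And>x. x \<in> set l \<Longrightarrow> \<bar>real_of_int x\<bar> \<le> t"
        using l tgauss_bounds(1)[OF sg less_imp_le[OF t0]] by (auto simp: set_replicate_pmf)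
      have e: "dim_vec e = M" "\<And>i. i < M \<Longrightarrow> \<bar>real_of_int (e $ i)\<bar> \<le> t"
        using len lt by (auto simp: e_def vec_of_list_index)
      define E where "E = (\<Sum>i<M. \<bar>real_of_int (e $ i)\<bar>)"
      have E: "E = (\<Sum>x\<leftarrow>l. real_of_int \<bar>x\<bar>)"
        unfolding E_def using len by (simp add: e_def vec_of_list_index sum_list_sum_nth lessThan_atLeast0)
      have "E = 0" if "t < 1"
      proof -
        \<comment> \<open>An integer of absolute value below 1 is 0.\<close>
        have "e $ i = 0" if "i < M" for i using e(2)[OF that] \<open>t < 1\<close> by linarith
        then show ?thesis by (simp add: E_def)
      qed
      then have sl: "E / (2 * real_of_int \<lfloor>t\<rfloor> + 1) \<le> 2 / 3 * (E / t)"
        using t0 by (intro shift_loss) (auto simp: E_def sum_nonneg)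
      show ?thesis
        unfolding rest_def e_def[symmetric]
      proof (rule pmf_bind_ge, clarify, rule pmf_bind_ge, rule pmf_bind_ge)
        fix A tr b f
        assume At: "(A, tr) \<in> set_pmf (GenTrap lam)" and f: "f \<in> set_pmf (pmf_of_set (Zvec 2 M))"
        have f: "f \<in> Zvec 2 M" using f Zvec_nonempty[of 2 M] by (simp add: finite_Zvec)
        have A: "A \<in> Zmat p M N" using GenTrap_range[OF lam At] by (simp add: defs)
        then have Ac: "A \<in> carrier_mat M N" by (simp add: Zmat_def)
        \<comment> \<open>The protocol adds the reduced error, while the bounds concern the integer
          error; the final reduction makes both give the same \<open>v\<close>.\<close>
        define v where "v = redv p (A *\<^sub>v s + redv p e)"
        have v: "v = redv p (A *\<^sub>v s + e)"
          unfolding v_def by (rule eq_vecI) (use e(1) in \<open>auto simp: mod_simps\<close>)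
        have ir: "Invert lam A y tr \<in> Zvec p N" if "y \<in> Zvec p M" for y
          using Invert_range[OF lam] A that by (simp add: defs)
        have ic: "Invert lam A (redv p (A *\<^sub>v x + g)) tr = x"
          if "x \<in> Zvec p N" "g \<in> Zvec p M" "real_of_int (zq_norm p g) \<le> 2 * t" for x g
          using Invert_correct[OF lam At] that by (simp add: defs)
        define w where "w = (f \<bullet> v + of_bool b * \<lfloor>real p / 4\<rfloor>) mod int p"
        define a where "a = redv p (A\<^sup>T *\<^sub>v f)"
        define game where "game = (\<lambda>b'. honest_bob\<^sub>1 N M p R t (A, v) (a, w) \<bind> (\<lambda>((y, u), st).
          honest_bob\<^sub>2 N R st b' \<bind> (\<lambda>d. return_pmf ((bdot u (bxor (vec_bits R (Invert lam A y tr))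
          (vec_bits R (Invert lam A (redv p (y + v)) tr))) \<noteq> d) \<longleftrightarrow> (b \<and> b')))))"
        have game: "1 / 2 + sqrt 2 / 4 - loss E \<le> pmf (game b') True" for b'
        proof -
          have "1 / 2 + sqrt 2 / 4 - pi / real p * (E + 1) - sqrt 2 / 4 * (E / (2 * real_of_int \<lfloor>t\<rfloor> + 1)) \<le> pmf (game b') True"
            unfolding E_def game_def
            by (rule success_bound[where Inv = "\<lambda>y. Invert lam A y tr"])
              (use p3 pR M5 t0 t4 Ac s e v ir ic f a_def w_def in auto)
          moreover have "sqrt 2 / 4 * (E / (2 * real_of_int \<lfloor>t\<rfloor> + 1)) \<le> sqrt 2 / 4 * (2 / 3 * (E / t))"
            using sl by (intro mult_left_mono) auto
          ultimately show ?thesis by (simp add: loss_def)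
        qed
        \<comment> \<open>Bob's first move does not see \<open>b'\<close>, so the coin can be drawn
          before it and the bound applied for each value of \<open>b'\<close>.\<close>
        have "honest_bob\<^sub>1 N M p R t (A, v) (a, w) \<bind> (\<lambda>((y, u), st). coin \<bind> (\<lambda>b'. honest_bob\<^sub>2 N R st b' \<bind> (\<lambda>d'.
          return_pmf ((bdot u (bxor (vec_bits R (Invert lam A y tr))
            (vec_bits R (Invert lam A (redv p (y + v)) tr))) \<noteq> d') = (b \<and> b'))))) = coin \<bind> game"
          unfolding game_def by (subst bind_commute_pmf) (simp add: case_prod_unfold)
        then show "1 / 2 + sqrt 2 / 4 - loss (\<Sum>x\<leftarrow>l. real_of_int \<bar>x\<bar>) \<le> pmf
          (honest_bob\<^sub>1 N M p R t (A, redv p (A *\<^sub>v s + redv p e))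
            (redv p (A\<^sup>T *\<^sub>v f), (f \<bullet> redv p (A *\<^sub>v s + redv p e) + of_bool b * \<lfloor>real p / 4\<rfloor>) mod int p) \<bind>
          (\<lambda>((y, u), st). coin \<bind> (\<lambda>b'. honest_bob\<^sub>2 N R st b' \<bind> (\<lambda>d'.
            return_pmf ((bdot u (bxor (vec_bits R (Invert lam A y tr))
              (vec_bits R (Invert lam A (redv p (y + redv p (A *\<^sub>v s + redv p e))) tr))) \<noteq> d') = (b \<and> b')))))) True"
          unfolding v_def[symmetric] a_def[symmetric] w_def[symmetric] E[symmetric]
          using game by (auto intro: pmf_bind_ge)
      qed
    qed
    define P where "P = replicate_pmf M (tgauss (\<sigma> lam) t)"
    have fin: "finite (set_pmf P)"
      using finite_lists_length_eq[OF tgauss_bounds(2)[OF sg less_imp_le[OF t0]], of M]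
      by (simp add: P_def set_replicate_pmf lists_eq_set)
    define W where "W = (\<lambda>l. \<Sum>x\<leftarrow>l. real_of_int \<bar>x :: int\<bar>)"
    define \<gamma> where "\<gamma> = pi / real p + sqrt 2 / 4 * (2 / 3 / t)"
    have aff: "loss E = pi / real p + \<gamma> * E" for E
      by (simp add: loss_def \<gamma>_def algebra_simps add_divide_distrib)
    have "L \<le> 1 / 2 + sqrt 2 / 4 - (pi / real p + \<gamma> * measure_pmf.expectation P W)"
    proof -
      have "\<gamma> \<ge> 0" using p3 t0 by (simp add: \<gamma>_def)
      then have "\<gamma> * measure_pmf.expectation P W \<le> \<gamma> * (real M * (4 / 3 * \<sigma> lam))"
        unfolding P_def W_def using expectation_sum_list_tgauss[OF sg less_imp_le[OF t0]] by (intro mult_left_mono)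
      then show ?thesis by (simp add: L_def aff)
    qed
    also have "\<dots> = measure_pmf.expectation P (\<lambda>l. 1 / 2 + sqrt 2 / 4 - loss (W l))"
    proof -
      have "integrable (measure_pmf P) W"
        using fin by (rule integrable_measure_pmf_finite)
      then show ?thesis unfolding aff by simp
    qed
    also have "\<dots> \<le> pmf (P \<bind> (\<lambda>l. rest (redv p (vec_of_list l)))) True"
      using fin rest by (intro pmf_bind_ge_expectation) (auto simp: P_def W_def)
    finally show "L \<le> pmf (map_pmf (redv p) (iid_vec M (tgauss (\<sigma> lam) t)) \<bind> (\<lambda>e. GenTrap lam \<bind> (\<lambda>(A, tr). coin \<bind> (\<lambda>b. pmf_of_set (Zvec 2 M) \<bind> (\<lambda>f.
      honest_bob\<^sub>1 N M p R t (A, redv p (A *\<^sub>v s + e))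
        (redv p (A\<^sup>T *\<^sub>v f), (f \<bullet> redv p (A *\<^sub>v s + e) + of_bool b * \<lfloor>real p / 4\<rfloor>) mod int p) \<bind>
      (\<lambda>((y, u), st). coin \<bind> (\<lambda>b'. honest_bob\<^sub>2 N R st b' \<bind> (\<lambda>d'.
        return_pmf ((bdot u (bxor (vec_bits R (Invert lam A y tr))
          (vec_bits R (Invert lam A (redv p (y + redv p (A *\<^sub>v s + e))) tr))) \<noteq> d') = (b \<and> b')))))))))) True"
      unfolding rest_def[symmetric] by (simp add: iid_vec_def P_def bind_map_pmf)
  qed
  moreover have "(cos (pi / 8))\<^sup>2 = 1 / 2 + sqrt 2 / 4"
  proof -
    have "cos (pi / 4) = 2 * (cos (pi / 8))\<^sup>2 - 1" using cos_double_cos[of "pi / 8"] by simp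
    then show ?thesis unfolding cos_45 by linarith
  qed
  moreover have "loss (real M * (4 / 3 * \<sigma> lam)) \<le> real M * \<sigma> lam / (2 * t)"
    unfolding loss_def by (rule total_loss) (use p3 sg M5 R2 t in auto)
  moreover have "5 * real M * (\<sigma> lam)\<^sup>2 / (real p)\<^sup>2 \<ge> 0" by simp
  ultimately show ?thesis unfolding L_def defs by linarith
qed

end
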